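(* Let $\mathbb{F}$ be an algebraically closed field, let $\Sigma\subseteq\mathbb{F}$ be nonempty, let $G(\lambda)\in\mathbb{F}(\lambda)^{p\times m}$ and let $$P(\lambda)=\begin{bmatrix}A(\lambda)&B(\lambda)\\-C(\lambda)&D(\lambda)\end{bmatrix}\in\mathbb{F}[\lambda]^{(n+p)\times(n+m)}$$ be a polynomial system matrix, with state matrix $A(\lambda)\in\mathbb{F}[\lambda]^{n\times n}$, which is minimal in $\Sigma$ and whose transfer function matrix is $G(\lambda)$. Then the elementary divisors of $A(\lambda)$ in $\Sigma$ are the pole elementary divisors of $G(\lambda)$ in $\Sigma$, and the elementary divisors of $P(\lambda)$ in $\Sigma$ are the zero elementary divisors of $G(\lambda)$ in $\Sigma$.
   Context: A square rational matrix is regular at $\lambda_0\in\mathbb{F}$ if none of its entries has a pole at $\lambda_0$ and its determinant is nonzero at $\lambda_0$. Every $G(\lambda)\in\mathbb{F}(\lambda)^{p\times m}$ of normal rank $r$ (rank over $\mathbb{F}(\lambda)$) can be written $G=R_1\,\mathrm{diag}\left((\lambda-\lambda_0)^{\nu_1},\ldots,(\lambda-\lambda_0)^{\nu_r},0_{(p-r)\times(m-r)}\right)R_2$ with $R_1,R_2$ rational and regular at $\lambda_0$, and with integers $\nu_1\le\cdots\le\nu_r$ uniquely determined by $G$ and $\lambda_0$, called the invariant orders of $G$ at $\lambda_0$. The pole elementary divisors of $G$ at $\lambda_0$ are the polynomials $(\lambda-\lambda_0)^{-\nu_i}$ for all $i$ with $\nu_i<0$, and the zero elementary divisors are $(\lambda-\lambda_0)^{\nu_i}$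 for all $i$ with $\nu_i>0$ (counted with repetition). For a polynomial matrix all $\nu_i\ge0$, and its elementary divisors at $\lambda_0$ are the $(\lambda-\lambda_0)^{\nu_i}$ with $\nu_i\neq0$. (Pole, zero) elementary divisors in $\Sigma$ means those at all the points $\lambda_0\in\Sigma$. A polynomial system matrix is a polynomial matrix partitioned as $P(\lambda)=\begin{bmatrix}A&B\\-C&D\end{bmatrix}$ with $A(\lambda)$ an $n\times n$ polynomial matrix with $\det A(\lambda)\not\equiv0$ (if $n>0$); $A$ is its state matrix and $D+CA^{-1}B$ is its transfer function matrix. If $n=0$, the blocks $A,B,C$ are empty and $P=G=D$. For $n>0$, $P$ is minimal at $\lambda_0$ if $\operatorname{rank}\begin{bmatrix}A(\lambda_0)\\C(\lambda_0)\end{bmatrix}=\operatorname{rank}\begin{bmatrix}A(\lambda_0)&B(\lambda_0)\end{bmatrix}=n$; if $n=0$, $P$ is by convention minimal at every point of $\mathbb{F}$. $P$ is minimal in $\Sigma$ if it is minimal at each $\lambda_0\in\Sigma$. *)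

theory Defs
  imports
    Jordan_Normal_Form.DL_Rank
    Jordan_Normal_Form.Gauss_Jordan_Elimination
    "HOL-Library.Multiset"
begin

text \<open>
  The field of rational functions over \<open>'a\<close> is \<open>'a poly fract\<close>, with \<open>to_fract\<close> the embedding of
  the polynomials.
\<close>

definition has_pole_at :: "'a::field poly fract \<Rightarrow> 'a \<Rightarrow> bool" where
  "has_pole_at f l \<longleftrightarrow> \<not> (\<exists>a b. f = Fract a b \<and> poly b l \<noteq> 0)"

definition nonzero_at :: "'a::field poly fract \<Rightarrow> 'a \<Rightarrow> bool" where
  "nonzero_at f l \<longleftrightarrow> (\<exists>a b. f = Fract a b \<and> poly b l \<noteq> 0 \<and> poly a l / poly b l \<noteq> 0)"

definition regular_at :: "'a::field poly fract mat \<Rightarrow> 'a \<Rightarrow> bool" where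
  "regular_at R l \<longleftrightarrow> square_mat R \<and>
     (\<forall>i<dim_row R. \<forall>j<dim_col R. \<not> has_pole_at (R $$ (i, j)) l) \<and>
     nonzero_at (det R) l"

definition local_smith_mat :: "nat \<Rightarrow> nat \<Rightarrow> 'a::field \<Rightarrow> int list \<Rightarrow> 'a poly fract mat" where
  "local_smith_mat p m l \<nu>s = mat p m (\<lambda>(i, j).
     if i = j \<and> i < length \<nu>s then to_fract [:-l, 1:] powi (\<nu>s ! i) else 0)"

definition is_invariant_orders :: "'a::field poly fract mat \<Rightarrow> 'a \<Rightarrow> int list \<Rightarrow> bool" where
  "is_invariant_orders G l \<nu>s \<longleftrightarrow>
     sorted \<nu>s \<and> length \<nu>s = vec_space.rank (dim_row G) G \<and>
     (\<exists>R1 \<in> carrier_mat (dim_row G) (dim_row G). \<exists>R2 \<in> carrier_mat (dim_col G) (dim_col G).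
        regular_at R1 l \<and> regular_at R2 l \<and>
        G = R1 * local_smith_mat (dim_row G) (dim_col G) l \<nu>s * R2)"

text \<open>
  Every rational matrix has exactly one list of invariant orders at every point (existence and
  uniqueness of the local Smith--McMillan form), so the description below is proper.
\<close>

definition invariant_orders :: "'a::field poly fract mat \<Rightarrow> 'a \<Rightarrow> int list" where
  "invariant_orders G l = (THE \<nu>s. is_invariant_orders G l \<nu>s)"

definition pole_elementary_divisors_at :: "'a::field poly fract mat \<Rightarrow> 'a \<Rightarrow> 'a poly multiset" where
  "pole_elementary_divisors_at G l =
     {#[:-l, 1:] ^ nat (- \<nu>) | \<nu> \<in># mset (invariant_orders G l). \<nu> < 0#}"

definition zero_elementary_divisors_at :: "'a::field poly fract mat \<Rightarrow> 'a \<Rightarrow> 'a poly multiset" where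
  "zero_elementary_divisors_at G l =
     {#[:-l, 1:] ^ nat \<nu> | \<nu> \<in># mset (invariant_orders G l). \<nu> > 0#}"

text \<open>For a polynomial matrix all invariant orders are nonnegative, so \<open>nat\<close> does not truncate.\<close>

definition elementary_divisors_at :: "'a::field poly mat \<Rightarrow> 'a \<Rightarrow> 'a poly multiset" where
  "elementary_divisors_at M l =
     {#[:-l, 1:] ^ nat \<nu> | \<nu> \<in># mset (invariant_orders (map_mat to_fract M) l). \<nu> \<noteq> 0#}"

text \<open>
  The elementary divisors in a set of points, counted with repetition, are given by their
  multiplicity function. A polynomial is an elementary divisor at no more than one point, so the
  sum below has at most one term, even if the set of points is infinite.
\<close>

definition collected_in :: "'a set \<Rightarrow> ('a \<Rightarrow> 'a::field poly multiset) \<Rightarrow> 'a poly \<Rightarrow> nat" where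
  "collected_in S E q = (\<Sum>l | l \<in> S \<and> q \<in># E l. count (E l) q)"

definition pole_elementary_divisors_in :: "'a set \<Rightarrow> 'a::field poly fract mat \<Rightarrow> 'a poly \<Rightarrow> nat" where
  "pole_elementary_divisors_in S G = collected_in S (pole_elementary_divisors_at G)"

definition zero_elementary_divisors_in :: "'a set \<Rightarrow> 'a::field poly fract mat \<Rightarrow> 'a poly \<Rightarrow> nat" where
  "zero_elementary_divisors_in S G = collected_in S (zero_elementary_divisors_at G)"

definition elementary_divisors_in :: "'a set \<Rightarrow> 'a::field poly mat \<Rightarrow> 'a poly \<Rightarrow> nat" where
  "elementary_divisors_in S M = collected_in S (elementary_divisors_at M)"

text \<open>
  Two such collections, each consisting of nontrivial powers of \<open>[:-l, 1:]\<close> at every point \<open>l\<close>,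
  agree in \<open>S\<close> exactly if they agree as multisets at every point of \<open>S\<close>.
\<close>

lemma collected_in_power:
  fixes E :: "'a::field \<Rightarrow> 'a poly multiset"
  assumes E: "\<And>l q. q \<in># E l \<Longrightarrow> \<exists>k>0. q = [:-l, 1:] ^ k"
    and "l \<in> S" "k > 0"
  shows "collected_in S E ([:-l, 1:] ^ k) = count (E l) ([:-l, 1:] ^ k)"
proof -
  have "l' = l" if "[:-l, 1:] ^ k \<in># E l'" for l'
  proof -
    obtain j where "j > 0" "[:-l, 1:] ^ k = [:-l', 1:] ^ j"
      using E \<open>[:-l, 1:] ^ k \<in># E l'\<close> by blast
    then have "poly ([:-l, 1:] ^ k) l' = 0"
      by (simp add: poly_power zero_power)
    then show ?thesis
      by (simp add: poly_power)
  qed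
  then have "{l'. l' \<in> S \<and> [:-l, 1:] ^ k \<in># E l'}
      = (if [:-l, 1:] ^ k \<in># E l then {l} else {})"
    using \<open>l \<in> S\<close> by auto
  then show ?thesis
    by (simp add: collected_in_def not_in_iff)
qed

lemma collected_in_eq_iff:
  fixes E F :: "'a::field \<Rightarrow> 'a poly multiset"
  assumes E: "\<And>l q. q \<in># E l \<Longrightarrow> \<exists>k>0. q = [:-l, 1:] ^ k"
    and F: "\<And>l q. q \<in># F l \<Longrightarrow> \<exists>k>0. q = [:-l, 1:] ^ k"
  shows "collected_in S E = collected_in S F \<longleftrightarrow> (\<forall>l\<in>S. E l = F l)"
proof
  assume eq: "collected_in S E = collected_in S F"
  show "\<forall>l\<in>S. E l = F l"
  proof (intro ballI multiset_eqI)
    fix l q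
    assume "l \<in> S"
    show "count (E l) q = count (F l) q"
    proof (cases "\<exists>k>0. q = [:-l, 1:] ^ k")
      case True
      then show ?thesis
        using eq collected_in_power[OF E \<open>l \<in> S\<close>] collected_in_power[OF F \<open>l \<in> S\<close>] by metis
    next
      case False
      then have "q \<notin># E l" "q \<notin># F l"
        using E F by blast+
      then show ?thesis
        by (simp add: not_in_iff)
    qed
  qed
next
  assume "\<forall>l\<in>S. E l = F l"
  then show "collected_in S E = collected_in S F"
    by (auto simp: collected_in_def fun_eq_iff intro!: sum.cong)
qed

text \<open>
  A polynomial system matrix is given by its blocks \<open>A\<close>, \<open>B\<close>, \<open>C\<close>, \<open>D\<close>, where the lower left
  block is \<open>-C\<close>. If \<open>n = 0\<close>, the blocks \<open>A\<close>, \<open>B\<close>, \<open>C\<close> are empty and \<open>system_matrix A B C D = D\<close>.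
\<close>

definition is_polynomial_system ::
    "nat \<Rightarrow> nat \<Rightarrow> nat \<Rightarrow> 'a::field poly mat \<Rightarrow> 'a poly mat \<Rightarrow> 'a poly mat \<Rightarrow> 'a poly mat \<Rightarrow> bool" where
  "is_polynomial_system n p m A B C D \<longleftrightarrow>
     A \<in> carrier_mat n n \<and> B \<in> carrier_mat n m \<and> C \<in> carrier_mat p n \<and> D \<in> carrier_mat p m \<and>
     (n > 0 \<longrightarrow> det A \<noteq> 0)"

definition system_matrix ::
    "'a::field poly mat \<Rightarrow> 'a poly mat \<Rightarrow> 'a poly mat \<Rightarrow> 'a poly mat \<Rightarrow> 'a poly mat" where
  "system_matrix A B C D = four_block_mat A B (- C) D"

definition transfer_function ::
    "'a::field poly mat \<Rightarrow> 'a poly mat \<Rightarrow> 'a poly mat \<Rightarrow> 'a poly mat \<Rightarrow> 'a poly fract mat" where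
  "transfer_function A B C D =
     map_mat to_fract D +
     map_mat to_fract C * the (mat_inverse (map_mat to_fract A)) * map_mat to_fract B"

definition eval_mat :: "'a::field poly mat \<Rightarrow> 'a \<Rightarrow> 'a mat" where
  "eval_mat M l = map_mat (\<lambda>q. poly q l) M"

definition append_cols :: "'a::zero mat \<Rightarrow> 'a mat \<Rightarrow> 'a mat" where
  "append_cols A B = four_block_mat A B (0\<^sub>m 0 (dim_col A)) (0\<^sub>m 0 (dim_col B))"

definition minimal_at ::
    "'a::field poly mat \<Rightarrow> 'a poly mat \<Rightarrow> 'a poly mat \<Rightarrow> 'a \<Rightarrow> bool" where
  "minimal_at A B C l \<longleftrightarrow> (let n = dim_row A; p = dim_row C in
     n > 0 \<longrightarrow>
       vec_space.rank (n + p) (eval_mat A l @\<^sub>r eval_mat C l) = n \<and>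
       vec_space.rank n (append_cols (eval_mat A l) (eval_mat B l)) = n)"

definition minimal_in ::
    "'a::field poly mat \<Rightarrow> 'a poly mat \<Rightarrow> 'a poly mat \<Rightarrow> 'a set \<Rightarrow> bool" where
  "minimal_in A B C S \<longleftrightarrow> (\<forall>l\<in>S. minimal_at A B C l)"

end

theory Submission
  imports Defs
begin

text \<open>
  Fix a point $\lambda_0$ and work over the valuation ring of the rational functions without pole at
  $\lambda_0$. Gaussian elimination whose pivot divides all remaining entries gives the local
  Smith--McMillan form. Its uniqueness: if $Q M = M' R$ for two monomial matrices $M$, $M'$ and
  matrices $Q$, $R$ invertible over the valuation ring, and $M$ had more entries dividing a given
  element than $M'$, then modulo the maximal ideal $Q$ would have a zero block too large for
  $\det Q$ to be a unit.

  Minimality at $\lambda_0$ gives Bezout identities $A X + B Y = I$ and $X' A + Y' C = I$ over the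
  valuation ring. They turn $P \oplus A^{-1}$ by equivalence into $G \oplus I_{2n}$. Hence the
  invariant orders of $P$ together with the negated ones of $A$ are those of $G$ together with $2n$
  zeros; as the orders of $A$ and $P$ are nonnegative, separating signs gives the claim.
\<close>

section \<open>Monomial matrices\<close>

text \<open>The obstacle is that $A^{-1}$ is in general not integral at the point, so the usual
  elimination of the state block from $P$ is no equivalence over the valuation ring. Carrying
  $A^{-1}$ along as a further diagonal block removes it: all transformation matrices stay integral,
  and $A^{-1}$ enters only as data, through [A; -C] A^-1 [A B] = P - diag(0, G). The Bezout
  identities provide integral one-sided inverses of [A; -C] and [A B]; multiplied with $P$ these
  produce one identity block of size n in a border column and one in a border row, and these account
  for the n + n zero orders. The price is small, since the orders of $A^{-1}$ are those of $A$
  negated. Orders are compared as multisets of exponents of monomial matrices, so block sums need no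
  sorting; the sorted list of the definition is recovered only once. As that list is introduced by a
  definite description and its length is the rank, existence, uniqueness and the rank of a monomial
  form all have to be established before anything can be read off.\<close>

definition monomial_mat :: "nat \<Rightarrow> nat \<Rightarrow> nat set \<Rightarrow> (nat \<Rightarrow> nat) \<Rightarrow> (nat \<Rightarrow> 'k::zero) \<Rightarrow> 'k mat" where
  "monomial_mat p m I \<sigma> d = mat p m (\<lambda>(i, j). if i \<in> I \<and> j = \<sigma> i then d i else 0)"

text \<open>Pivots are recorded where they occur, by a set of rows and an injective choice of
  columns. Elimination then needs no exchanges, and block sums of such matrices are again of this
  kind.\<close>

definition monomial_data :: "nat \<Rightarrow> nat \<Rightarrow> nat set \<Rightarrow> (nat \<Rightarrow> nat) \<Rightarrow> (nat \<Rightarrow> 'k::zero) \<Rightarrow> bool" where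
  "monomial_data p m I \<sigma> d \<longleftrightarrow> I \<subseteq> {..<p} \<and> \<sigma> ` I \<subseteq> {..<m} \<and> inj_on \<sigma> I \<and> (\<forall>i\<in>I. d i \<noteq> 0)"

lemma monomial_mat_carrier [simp]: "monomial_mat p m I \<sigma> d \<in> carrier_mat p m"
  by (simp add: monomial_mat_def)

lemma dim_monomial_mat [simp]: "dim_row (monomial_mat p m I \<sigma> d) = p" "dim_col (monomial_mat p m I \<sigma> d) = m"
  by (simp_all add: monomial_mat_def)

lemma index_monomial_mat [simp]:
  "i < p \<Longrightarrow> j < m \<Longrightarrow> monomial_mat p m I \<sigma> d $$ (i, j) = (if i \<in> I \<and> j = \<sigma> i then d i else 0)"
  by (simp add: monomial_mat_def)

lemma mat_mult_index_sum:
  "A \<in> carrier_mat n k \<Longrightarrow> B \<in> carrier_mat k m \<Longrightarrow> i < n \<Longrightarrow> j < m \<Longrightarrow>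
   (A * B) $$ (i, j) = (\<Sum>l<k. A $$ (i, l) * B $$ (l, j))"
  by (simp add: scalar_prod_def atLeast0LessThan)

lemma mult_monomial_mat_index:
  fixes Q :: "'k::semiring_0 mat"
  assumes Q: "Q \<in> carrier_mat n p" and d: "monomial_data p m I \<sigma> d" and i: "i < n" and a: "a \<in> I"
  shows "(Q * monomial_mat p m I \<sigma> d) $$ (i, \<sigma> a) = Q $$ (i, a) * d a"
proof -
  have a': "a < p" "\<sigma> a < m" using d a by (auto simp: monomial_data_def)
  have "(Q * monomial_mat p m I \<sigma> d) $$ (i, \<sigma> a)
      = (\<Sum>l<p. Q $$ (i, l) * monomial_mat p m I \<sigma> d $$ (l, \<sigma> a))"
    by (rule mat_mult_index_sum[OF Q _ i]) (use a' in auto)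
  also have "\<dots> = (\<Sum>l<p. if l = a then Q $$ (i, a) * d a else 0)"
    using d a a' by (intro sum.cong refl) (auto simp: monomial_data_def inj_on_def)
  finally show ?thesis using a' by simp
qed

lemma mult_monomial_mat_index_outside:
  fixes Q :: "'k::semiring_0 mat"
  assumes Q: "Q \<in> carrier_mat n p" and i: "i < n" and j: "j < m" "j \<notin> \<sigma> ` I"
  shows "(Q * monomial_mat p m I \<sigma> d) $$ (i, j) = 0"
proof -
  have "(Q * monomial_mat p m I \<sigma> d) $$ (i, j) = (\<Sum>l<p. Q $$ (i, l) * monomial_mat p m I \<sigma> d $$ (l, j))"
    by (rule mat_mult_index_sum[OF Q _ i j(1)]) auto
  also have "\<dots> = 0"
    using j by (intro sum.neutral) auto
  finally show ?thesis .
qed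

lemma monomial_mat_mult_index:
  fixes R :: "'k::semiring_0 mat"
  assumes R: "R \<in> carrier_mat m k" and d: "monomial_data p m I \<sigma> d" and i: "i < p" and j: "j < k"
  shows "(monomial_mat p m I \<sigma> d * R) $$ (i, j) = (if i \<in> I then d i * R $$ (\<sigma> i, j) else 0)"
proof -
  have "(monomial_mat p m I \<sigma> d * R) $$ (i, j) = (\<Sum>l<m. monomial_mat p m I \<sigma> d $$ (i, l) * R $$ (l, j))"
    by (rule mat_mult_index_sum[OF _ R i j]) auto
  also have "\<dots> = (\<Sum>l<m. if l = \<sigma> i then if i \<in> I then d i * R $$ (\<sigma> i, j) else 0 else 0)"
    using i by (intro sum.cong refl) auto
  also have "\<dots> = (if i \<in> I then d i * R $$ (\<sigma> i, j) else 0)"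
    using d by (auto simp: monomial_data_def)
  finally show ?thesis .
qed

section \<open>Equivalence over a valuation subring\<close>

text \<open>Kept abstract for the sake of two instances: the local ring at a point, and the whole
  field, where the equivalence below becomes ordinary rank equivalence. The axiom
  \<open>total\<close> is consistent with 0 because \<open>inverse 0 = 0\<close>.\<close>

locale valuation_subring =
  fixes V :: "'k::field set"
  assumes one_in [simp, intro]: "1 \<in> V"
    and add_in [simp, intro]: "x \<in> V \<Longrightarrow> y \<in> V \<Longrightarrow> x + y \<in> V"
    and uminus_in [simp, intro]: "x \<in> V \<Longrightarrow> - x \<in> V"
    and mult_in [simp, intro]: "x \<in> V \<Longrightarrow> y \<in> V \<Longrightarrow> x * y \<in> V"
    and total: "x \<in> V \<or> inverse x \<in> V"
begin

lemma zero_in [simp, intro]: "0 \<in> V"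
  using add_in[OF one_in uminus_in[OF one_in]] by simp

lemma sum_in [simp, intro]: "(\<And>i. i \<in> A \<Longrightarrow> f i \<in> V) \<Longrightarrow> sum f A \<in> V"
  by (induction A rule: infinite_finite_induct) auto

lemma prod_in [simp, intro]: "(\<And>i. i \<in> A \<Longrightarrow> f i \<in> V) \<Longrightarrow> prod f A \<in> V"
  by (induction A rule: infinite_finite_induct) auto

text \<open>This is the maximal ideal. The element 0 is listed separately, since
  \<open>inverse 0 = 0\<close> lies in \<open>V\<close>.\<close>

definition nonunits :: "'k set" where
  "nonunits = {x \<in> V. x = 0 \<or> inverse x \<notin> V}"

lemma zero_nonunit: "0 \<in> nonunits"
  by (simp add: nonunits_def)

lemma one_notin_nonunits: "1 \<notin> nonunits"
  by (simp add: nonunits_def)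

lemma nonunits_mult:
  assumes "x \<in> nonunits" "y \<in> V"
  shows "x * y \<in> nonunits"
proof -
  have "inverse x \<in> V" if "inverse (x * y) \<in> V" "y \<noteq> 0"
    using mult_in[OF assms(2) that(1)] that(2) by (simp add: field_simps)
  then show ?thesis using assms by (auto simp: nonunits_def)
qed

lemma nonunits_add:
  assumes "x \<in> nonunits" "y \<in> nonunits"
  shows "x + y \<in> nonunits"
proof -
  \<comment> \<open>One of the two quotients of nonzero elements is integral, by
    \<open>total\<close>; if it is \<open>x / y\<close>, the sum is an integral multiple of
    \<open>y\<close>.\<close>
  have *: "x + y \<in> nonunits" if "x \<in> nonunits" "y \<in> nonunits" "x / y \<in> V" "y \<noteq> 0" for x y
  proof -
    have "x + y = y * (1 + x / y)"
      using that(4) by (simp add: field_simps)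
    then show ?thesis
      using nonunits_mult[OF that(2) add_in[OF one_in that(3)]] by simp
  qed
  show ?thesis
  proof (cases "x = 0 \<or> y = 0")
    case False
    then show ?thesis
      using *[of x y] *[of y x] total[of "x / y"] assms by (auto simp: add.commute)
  qed (use assms in auto)
qed

lemma nonunits_sum: "(\<And>i. i \<in> A \<Longrightarrow> f i \<in> nonunits) \<Longrightarrow> sum f A \<in> nonunits"
  by (induction A rule: infinite_finite_induct) (auto intro: nonunits_add simp: zero_nonunit)

definition omat :: "nat \<Rightarrow> nat \<Rightarrow> 'k mat set" where
  "omat n m = {M \<in> carrier_mat n m. \<forall>i<n. \<forall>j<m. M $$ (i, j) \<in> V}"

definition gl :: "nat \<Rightarrow> 'k mat set" where
  "gl n = {M \<in> omat n n. \<exists>N \<in> omat n n. M * N = 1\<^sub>m n \<and> N * M = 1\<^sub>m n}"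

text \<open>Only the transformations have to be integral; \<open>G\<close> and \<open>H\<close> are
  arbitrary over the field. This admits matrices with poles, such as the transfer function and the
  inverse of the state matrix.\<close>

definition oequiv :: "nat \<Rightarrow> nat \<Rightarrow> 'k mat \<Rightarrow> 'k mat \<Rightarrow> bool" where
  "oequiv p m G H \<longleftrightarrow> H \<in> carrier_mat p m \<and> (\<exists>L \<in> gl p. \<exists>R \<in> gl m. G = L * H * R)"

lemma omat_carrier: "M \<in> omat n m \<Longrightarrow> M \<in> carrier_mat n m"
  by (simp add: omat_def)

lemma gl_omat: "M \<in> gl n \<Longrightarrow> M \<in> omat n n"
  by (simp add: gl_def)

lemma gl_carrier: "M \<in> gl n \<Longrightarrow> M \<in> carrier_mat n n"
  by (simp add: gl_def omat_def)

lemma omat_index: "M \<in> omat n m \<Longrightarrow> i < n \<Longrightarrow> j < m \<Longrightarrow> M $$ (i, j) \<in> V"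
  by (simp add: omat_def)

lemma omat_one [simp]: "1\<^sub>m n \<in> omat n n"
  by (auto simp: omat_def)

lemma omat_zero [simp]: "0\<^sub>m n m \<in> omat n m"
  by (auto simp: omat_def)

lemma omat_mult [intro]: "A \<in> omat n k \<Longrightarrow> B \<in> omat k m \<Longrightarrow> A * B \<in> omat n m"
  by (auto simp: omat_def mat_mult_index_sum simp del: index_mult_mat(1) intro!: sum_in mult_in)

lemma omat_uminus [intro]: "A \<in> omat n k \<Longrightarrow> - A \<in> omat n k"
  by (auto simp: omat_def)

lemma omat_add [intro]: "A \<in> omat n k \<Longrightarrow> B \<in> omat n k \<Longrightarrow> A + B \<in> omat n k"
  by (auto simp: omat_def)

lemma omat_transpose [intro]: "A \<in> omat n k \<Longrightarrow> transpose_mat A \<in> omat k n"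
  by (auto simp: omat_def)

lemma omat_four_block [intro]:
  assumes "A \<in> omat n1 m1" "B \<in> omat n1 m2" "C \<in> omat n2 m1" "D \<in> omat n2 m2"
  shows "four_block_mat A B C D \<in> omat (n1 + n2) (m1 + m2)"
  using assms by (auto simp: omat_def)

lemma glI: "M \<in> omat n n \<Longrightarrow> N \<in> omat n n \<Longrightarrow> M * N = 1\<^sub>m n \<Longrightarrow> N * M = 1\<^sub>m n \<Longrightarrow> M \<in> gl n"
  by (auto simp: gl_def)

lemma glE:
  assumes "M \<in> gl n"
  obtains N where "N \<in> gl n" "M * N = 1\<^sub>m n" "N * M = 1\<^sub>m n"
  using assms by (auto simp: gl_def)

lemma gl_one [simp]: "1\<^sub>m n \<in> gl n"
  by (rule glI[of _ _ "1\<^sub>m n"]) auto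

lemma gl_mult:
  assumes "A \<in> gl n" "B \<in> gl n"
  shows "A * B \<in> gl n"
proof -
  obtain A' B' where inv: "A' \<in> gl n" "A * A' = 1\<^sub>m n" "A' * A = 1\<^sub>m n"
      "B' \<in> gl n" "B * B' = 1\<^sub>m n" "B' * B = 1\<^sub>m n"
    using assms by (meson glE)
  note c = assms[THEN gl_carrier] inv(1,4)[THEN gl_carrier]
  have "A * B * (B' * A') = A * (B * B') * A'"
    using c by (simp add: assoc_mult_mat[of _ n n _ n _ n])
  moreover have "B' * A' * (A * B) = B' * (A' * A) * B"
    using c by (simp add: assoc_mult_mat[of _ n n _ n _ n])
  ultimately show ?thesis
    using c inv assms by (intro glI[of _ _ "B' * A'"] omat_mult[of _ n n]) (simp_all add: gl_omat)
qed

lemma gl_transpose: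
  assumes "A \<in> gl n"
  shows "transpose_mat A \<in> gl n"
proof -
  obtain A' where inv: "A' \<in> gl n" "A * A' = 1\<^sub>m n" "A' * A = 1\<^sub>m n"
    using assms by (rule glE)
  have "transpose_mat A * transpose_mat A' = 1\<^sub>m n" "transpose_mat A' * transpose_mat A = 1\<^sub>m n"
    using transpose_mult[of A n n A' n, symmetric] transpose_mult[of A' n n A n, symmetric]
      assms[THEN gl_carrier] inv(1)[THEN gl_carrier] by (simp_all only: inv(2,3) transpose_one)
  then show ?thesis
    using omat_transpose[OF gl_omat] assms inv(1) by (intro glI[of _ _ "transpose_mat A'"])
qed

lemma oequiv_carrier: "oequiv p m G H \<Longrightarrow> G \<in> carrier_mat p m \<and> H \<in> carrier_mat p m"
  by (auto simp: oequiv_def dest!: gl_carrier)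

lemma oequivI: "H \<in> carrier_mat p m \<Longrightarrow> L \<in> gl p \<Longrightarrow> R \<in> gl m \<Longrightarrow> G = L * H * R \<Longrightarrow> oequiv p m G H"
  unfolding oequiv_def by blast

text \<open>The last equation has one transformation on each side. If \<open>G\<close> and
  \<open>H\<close> are monomial, each entry of either side is a single product, which is what the
  uniqueness argument evaluates.\<close>

lemma oequivE:
  assumes "oequiv p m G H"
  obtains L L' R R' where "L \<in> gl p" "L' \<in> gl p" "R \<in> gl m" "R' \<in> gl m"
    "L * L' = 1\<^sub>m p" "L' * L = 1\<^sub>m p" "R * R' = 1\<^sub>m m" "R' * R = 1\<^sub>m m"
    "G = L * H * R" "H = L' * G * R'" "L' * G = H * R"
proof -
  obtain L R where 1: "L \<in> gl p" "R \<in> gl m" "G = L * H * R" "H \<in> carrier_mat p m"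
    using assms by (auto simp: oequiv_def)
  obtain L' where 2: "L' \<in> gl p" "L * L' = 1\<^sub>m p" "L' * L = 1\<^sub>m p" using glE[OF 1(1)] by metis
  obtain R' where 3: "R' \<in> gl m" "R * R' = 1\<^sub>m m" "R' * R = 1\<^sub>m m" using glE[OF 1(2)] by metis
  note c = 1(1,2)[THEN gl_carrier] 1(4) 2(1)[THEN gl_carrier] 3(1)[THEN gl_carrier]
  have "L' * G = L' * (L * (H * R))"
    unfolding 1(3) using assoc_mult_mat[of L p p H m R m] c by simp
  also have "\<dots> = L' * L * (H * R)"
    by (rule assoc_mult_mat[symmetric]) (use c in auto)
  finally have 4: "L' * G = H * R" using c 2 by simp
  have "L' * G * R' = H * (R * R')"
    unfolding 4 by (rule assoc_mult_mat) (use c in auto)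
  then have "L' * G * R' = H" using c 3 by simp
  then show ?thesis
    by (intro that[OF 1(1) 2(1) 1(2) 3(1) 2(2,3) 3(2,3) 1(3) _ 4]) (rule sym)
qed

lemma oequiv_refl: "G \<in> carrier_mat p m \<Longrightarrow> oequiv p m G G"
  by (rule oequivI[of _ _ _ "1\<^sub>m p" "1\<^sub>m m"]) auto

lemma oequiv_sym:
  assumes "oequiv p m G H"
  shows "oequiv p m H G"
  using assms
proof (rule oequivE)
  fix L' R'
  assume "L' \<in> gl p" "R' \<in> gl m" "H = L' * G * R'"
  then show ?thesis
    using oequiv_carrier[OF assms] by (intro oequivI[of _ _ _ L' R']) simp_all
qed

lemma oequiv_trans [trans]:
  assumes "oequiv p m G H" "oequiv p m H K"
  shows "oequiv p m G K"
proof -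
  obtain L R L' R' where 1: "L \<in> gl p" "R \<in> gl m" "G = L * H * R"
    "L' \<in> gl p" "R' \<in> gl m" "H = L' * K * R'" "K \<in> carrier_mat p m"
    using assms by (auto simp: oequiv_def)
  note c = 1(1,2,4,5)[THEN gl_carrier] 1(7)
  have "G = L * (L' * K * R' * R)"
    unfolding 1(3) 1(6) by (rule assoc_mult_mat) (use c in auto)
  also have "L' * K * R' * R = L' * K * (R' * R)"
    by (rule assoc_mult_mat) (use c in auto)
  also have "L * (L' * K * (R' * R)) = L * (L' * K) * (R' * R)"
    by (rule assoc_mult_mat[symmetric]) (use c in auto)
  also have "L * (L' * K) = L * L' * K"
    by (rule assoc_mult_mat[symmetric]) (use c in auto)
  finally show ?thesis using 1 by (intro oequivI[of _ _ _ "L * L'" "R' * R"] gl_mult)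
qed

lemma oequiv_left: "H \<in> carrier_mat p m \<Longrightarrow> L \<in> gl p \<Longrightarrow> oequiv p m (L * H) H"
  using gl_carrier by (intro oequivI[of _ _ _ L "1\<^sub>m m"]) simp_all

lemma oequiv_right: "H \<in> carrier_mat p m \<Longrightarrow> R \<in> gl m \<Longrightarrow> oequiv p m (H * R) H"
  by (rule oequivI[of _ _ _ "1\<^sub>m p" R]) simp_all

end

section \<open>Existence and uniqueness of monomial forms\<close>

text \<open>An elimination matrix: from the left it adds \<open>c i\<close> times row
  \<open>k\<close> to every other row \<open>i\<close>, so one product treats a whole column; its
  transpose does the same from the right. Row \<open>k\<close> stays fixed, hence negating
  \<open>c\<close> inverts it.\<close>

definition shear :: "nat \<Rightarrow> nat \<Rightarrow> (nat \<Rightarrow> 'k::comm_ring_1) \<Rightarrow> 'k mat" where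
  "shear n k c = mat n n (\<lambda>(i, j). (if i = j then 1 else 0) + (if j = k \<and> i \<noteq> k then c i else 0))"

lemma shear_carrier [simp]: "shear n k c \<in> carrier_mat n n"
  by (simp add: shear_def)

lemma dim_shear [simp]: "dim_row (shear n k c) = n" "dim_col (shear n k c) = n"
  by (simp_all add: shear_def)

lemma shear_mult_index:
  assumes X: "X \<in> carrier_mat n m" and k: "k < n" and i: "i < n" and j: "j < m"
  shows "(shear n k c * X) $$ (i, j) = X $$ (i, j) + (if i = k then 0 else c i * X $$ (k, j))"
proof -
  have "(shear n k c * X) $$ (i, j) = (\<Sum>l<n. shear n k c $$ (i, l) * X $$ (l, j))"
    by (rule mat_mult_index_sum[OF _ X i j]) simp
  also have "\<dots> = (\<Sum>l<n. (if l = i then X $$ (i, j) else 0)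
      + (if l = k then if i = k then 0 else c i * X $$ (k, j) else 0))"
    using i by (intro sum.cong refl) (auto simp: shear_def distrib_right)
  also have "\<dots> = X $$ (i, j) + (if i = k then 0 else c i * X $$ (k, j))"
    using i k by (simp add: sum.distrib)
  finally show ?thesis .
qed

lemma mult_transpose_shear_index:
  assumes X: "X \<in> carrier_mat n m" and k: "k < m" and i: "i < n" and j: "j < m"
  shows "(X * transpose_mat (shear m k c)) $$ (i, j) = X $$ (i, j) + (if j = k then 0 else c j * X $$ (i, k))"
proof -
  have "X * transpose_mat (shear m k c) = transpose_mat (shear m k c * transpose_mat X)"
    using transpose_mult[of "shear m k c" m m "transpose_mat X" n] X by simp
  then have "(X * transpose_mat (shear m k c)) $$ (i, j) = (shear m k c * transpose_mat X) $$ (j, i)"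
    using X i j by (simp del: index_mult_mat(1))
  then show ?thesis
    using shear_mult_index[of "transpose_mat X" m n k j i c] assms by simp
qed

lemma shear_mult_shear: "k < n \<Longrightarrow> shear n k c * shear n k (\<lambda>i. - c i) = 1\<^sub>m n"
proof (rule eq_matI)
  fix i j
  assume "i < dim_row (1\<^sub>m n :: 'a mat)" "j < dim_col (1\<^sub>m n :: 'a mat)" "k < n"
  then show "(shear n k c * shear n k (\<lambda>i. - c i)) $$ (i, j) = 1\<^sub>m n $$ (i, j)"
    by (subst shear_mult_index[of _ n n]) (auto simp: shear_def)
qed auto

definition perm_mat :: "nat \<Rightarrow> (nat \<Rightarrow> nat) \<Rightarrow> 'k::comm_ring_1 mat" where
  "perm_mat n \<pi> = mat n n (\<lambda>(i, j). if j = \<pi> i then 1 else 0)"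

lemma perm_mat_carrier [simp]: "perm_mat n \<pi> \<in> carrier_mat n n"
  by (simp add: perm_mat_def)

lemma dim_perm_mat [simp]: "dim_row (perm_mat n \<pi>) = n" "dim_col (perm_mat n \<pi>) = n"
  by (simp_all add: perm_mat_def)

lemma perm_mat_mult_index:
  assumes X: "X \<in> carrier_mat n m" and i: "i < n" "\<pi> i < n" and j: "j < m"
  shows "(perm_mat n \<pi> * X) $$ (i, j) = X $$ (\<pi> i, j)"
proof -
  have "(perm_mat n \<pi> * X) $$ (i, j) = (\<Sum>l<n. perm_mat n \<pi> $$ (i, l) * X $$ (l, j))"
    by (rule mat_mult_index_sum[OF _ X i(1) j]) simp
  also have "\<dots> = (\<Sum>l<n. if l = \<pi> i then X $$ (\<pi> i, j) else 0)"
    using i by (intro sum.cong refl) (auto simp: perm_mat_def)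
  finally show ?thesis using i by simp
qed

lemma mult_transpose_perm_mat_index:
  assumes X: "X \<in> carrier_mat n m" and i: "i < n" and j: "j < m" "\<pi> j < m"
  shows "(X * transpose_mat (perm_mat m \<pi>)) $$ (i, j) = X $$ (i, \<pi> j)"
proof -
  have "X * transpose_mat (perm_mat m \<pi>) = transpose_mat (perm_mat m \<pi> * transpose_mat X)"
    using transpose_mult[of "perm_mat m \<pi>" m m "transpose_mat X" n] X by simp
  then have "(X * transpose_mat (perm_mat m \<pi>)) $$ (i, j) = (perm_mat m \<pi> * transpose_mat X) $$ (j, i)"
    using X i j by (simp del: index_mult_mat(1))
  then show ?thesis
    using perm_mat_mult_index[of "transpose_mat X" m n j \<pi> i] assms by simp
qed

text \<open>Used to move pivots to the diagonal: their rows and columns prescribe only the first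
  values of a permutation of all indices.\<close>

lemma extend_to_permutation:
  fixes f :: "nat \<Rightarrow> nat"
  assumes f: "inj_on f {..<r}" "f ` {..<r} \<subseteq> {..<n}"
  obtains \<pi> where "bij_betw \<pi> {..<n} {..<n}" "\<And>i. i < r \<Longrightarrow> \<pi> i = f i"
proof -
  have "r \<le> n"
    using card_mono[OF _ f(2)] f(1) by (simp add: card_image)
  then have "card ({..<n} - {..<r}) = card ({..<n} - f ` {..<r})"
    using f by (simp add: card_Diff_subset card_image)
  then obtain h where h: "bij_betw h ({..<n} - {..<r}) ({..<n} - f ` {..<r})"
    by (metis finite_Diff finite_lessThan finite_same_card_bij)
  define \<pi> where "\<pi> i = (if i < r then f i else h i)" for i
  have "bij_betw \<pi> {..<r} (f ` {..<r})"
    using f(1) by (auto simp: bij_betw_def \<pi>_def inj_on_def)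
  moreover have "bij_betw \<pi> ({..<n} - {..<r}) ({..<n} - f ` {..<r})"
    using h by (subst bij_betw_cong[of _ _ h]) (auto simp: \<pi>_def)
  ultimately have "bij_betw \<pi> ({..<r} \<union> ({..<n} - {..<r})) (f ` {..<r} \<union> ({..<n} - f ` {..<r}))"
    by (rule bij_betw_combine) auto
  moreover have "{..<r} \<union> ({..<n} - {..<r}) = {..<n}" "f ` {..<r} \<union> ({..<n} - f ` {..<r}) = {..<n}"
    using \<open>r \<le> n\<close> f(2) by auto
  ultimately show ?thesis
    using that[of \<pi>] by (simp add: \<pi>_def)
qed

section \<open>Existence: elimination with a pivot dividing its row and column\<close>

context valuation_subring
begin

lemma shear_gl:
  assumes "k < n" "\<And>i. i < n \<Longrightarrow> i \<noteq> k \<Longrightarrow> c i \<in> V"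
  shows "shear n k c \<in> gl n"
proof (rule glI)
  show "shear n k c \<in> omat n n" "shear n k (\<lambda>i. - c i) \<in> omat n n"
    using assms by (auto simp: omat_def shear_def)
  show "shear n k c * shear n k (\<lambda>i. - c i) = 1\<^sub>m n" "shear n k (\<lambda>i. - c i) * shear n k c = 1\<^sub>m n"
    using shear_mult_shear[OF assms(1), of c] shear_mult_shear[OF assms(1), of "\<lambda>i. - c i"] by simp_all
qed

text \<open>The new matrix consists of the pivot and its Schur complement. Undoing the elimination
  multiplies by shears whose coefficients are the entries of the pivot column and row divided by the
  pivot, which are integral by assumption.\<close>

lemma oequiv_pivot:
  assumes G: "G \<in> carrier_mat p m" and k: "k < p" "l < m" and e: "e = G $$ (k, l)" "e \<noteq> 0"
    and col: "\<And>i. i < p \<Longrightarrow> G $$ (i, l) / e \<in> V" and row: "\<And>j. j < m \<Longrightarrow> G $$ (k, j) / e \<in> V"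
  shows "oequiv p m G (mat p m (\<lambda>(i, j). if i = k \<or> j = l then if i = k \<and> j = l then e else 0
    else G $$ (i, j) - G $$ (i, l) * G $$ (k, j) / e))" (is "oequiv p m G ?H")
proof (rule oequivI)
  let ?L = "shear p k (\<lambda>i. G $$ (i, l) / e)" and ?R = "transpose_mat (shear m l (\<lambda>j. G $$ (k, j) / e))"
  show "?H \<in> carrier_mat p m" by simp
  show "?L \<in> gl p" using k col by (intro shear_gl)
  show "?R \<in> gl m" using k row by (intro gl_transpose shear_gl)
  show "G = ?L * ?H * ?R"
  proof (rule eq_matI)
    fix i j
    assume "i < dim_row (?L * ?H * ?R)" "j < dim_col (?L * ?H * ?R)"
    then have ij: "i < p" "j < m" by auto
    have c: "?L * ?H \<in> carrier_mat p m"
      by (rule mult_carrier_mat[of _ _ p]) simp_all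
    show "G $$ (i, j) = (?L * ?H * ?R) $$ (i, j)"
      unfolding mult_transpose_shear_index[OF c k(2) ij]
        shear_mult_index[OF \<open>?H \<in> carrier_mat p m\<close> k(1) ij] shear_mult_index[OF \<open>?H \<in> carrier_mat p m\<close> k(1) ij(1) k(2)]
      using ij k e by (auto simp: field_simps)
  qed (use G in auto)
qed

text \<open>By \<open>total\<close>, divisibility over \<open>V\<close> is a total preorder, so a
  finite nonempty set of nonzero elements has a least one.\<close>

lemma finite_has_divisor:
  assumes "finite E" "E \<noteq> {}" "0 \<notin> E"
  shows "\<exists>e\<in>E. \<forall>x\<in>E. x / e \<in> V"
  using assms
proof (induction rule: finite_ne_induct)
  case (insert y E)
  then obtain e where e: "e \<in> E" "\<forall>x\<in>E. x / e \<in> V" by auto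
  show ?case
  proof (cases "y / e \<in> V")
    case False
    then have ey: "e / y \<in> V" using total[of "y / e"] by simp
    have "x / y \<in> V" if "x \<in> E" for x
    proof -
      have "e \<noteq> 0" using insert.prems e(1) by auto
      then have "x / y = (x / e) * (e / y)" by simp
      then show ?thesis using ey e(2) that mult_in by metis
    qed
    then show ?thesis using insert by (intro bexI[of _ y]) auto
  qed (use e insert in \<open>auto intro!: bexI[of _ e]\<close>)
qed auto

text \<open>The invariant of the elimination: the pivots found so far, with rows \<open>I\<close>,
  are alone in their rows and columns.\<close>

definition cleared :: "nat \<Rightarrow> nat \<Rightarrow> nat set \<Rightarrow> (nat \<Rightarrow> nat) \<Rightarrow> 'k mat \<Rightarrow> bool" where
  "cleared p m I \<sigma> G \<longleftrightarrow> monomial_data p m I \<sigma> (\<lambda>i. G $$ (i, \<sigma> i)) \<and>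
     (\<forall>i\<in>I. \<forall>j<m. j \<noteq> \<sigma> i \<longrightarrow> G $$ (i, j) = 0) \<and> (\<forall>i\<in>I. \<forall>k<p. k \<noteq> i \<longrightarrow> G $$ (k, \<sigma> i) = 0)"

lemma oequiv_monomial_of_cleared:
  assumes "G \<in> carrier_mat p m" "cleared p m I \<sigma> G"
  shows "\<exists>I \<sigma> d. monomial_data p m I \<sigma> d \<and> oequiv p m G (monomial_mat p m I \<sigma> d)"
  using assms
proof (induction "p - card I" arbitrary: G I \<sigma> rule: less_induct)
  case less
  note G = less.prems(1) and cl = less.prems(2)
  have I: "I \<subseteq> {..<p}" "\<sigma> ` I \<subseteq> {..<m}" "inj_on \<sigma> I" "\<And>i. i \<in> I \<Longrightarrow> G $$ (i, \<sigma> i) \<noteq> 0"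
    using cl by (auto simp: cleared_def monomial_data_def)
  have row0: "G $$ (i, j) = 0" if "i \<in> I" "j < m" "j \<noteq> \<sigma> i" for i j
    using cl that by (auto simp: cleared_def)
  have col0: "G $$ (k, \<sigma> i) = 0" if "i \<in> I" "k < p" "k \<noteq> i" for i k
    using cl that by (auto simp: cleared_def)
  have fI: "finite I" using I(1) finite_subset by blast
  \<comment> \<open>The pivot rows are already clear, so the next pivot is searched only in the
    remaining rows.\<close>
  define E where "E = {x. x \<noteq> 0 \<and> (\<exists>i<p. \<exists>j<m. i \<notin> I \<and> x = G $$ (i, j))}"
  show ?case
  proof (cases "E = {}")
    case True
    have "G $$ (i, j) = 0" if "i < p" "j < m" "i \<notin> I" for i j
      using True that unfolding E_def by blast
    then have "G = monomial_mat p m I \<sigma> (\<lambda>i. G $$ (i, \<sigma> i))"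
      by (intro eq_matI) (use G row0 in auto)
    then show ?thesis
      using cl G oequiv_refl unfolding cleared_def by metis
  next
    case False
    have "E \<subseteq> (\<lambda>(i, j). G $$ (i, j)) ` ({..<p} \<times> {..<m})" by (auto simp: E_def)
    then have "finite E" by (rule finite_subset) auto
    then obtain e where e: "e \<in> E" "\<And>x. x \<in> E \<Longrightarrow> x / e \<in> V"
      using finite_has_divisor[of E] False by (auto simp: E_def)
    then obtain k l where kl: "k < p" "l < m" "k \<notin> I" "e = G $$ (k, l)" "e \<noteq> 0"
      by (auto simp: E_def)
    have \<sigma>k: "G $$ (k, \<sigma> i) = 0" if "i \<in> I" for i
      using col0[of i k] that kl by auto
    then have l: "l \<noteq> \<sigma> i" if "i \<in> I" for i
      using that kl by auto
    have Gl: "G $$ (i, l) = 0" if "i \<in> I" for i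
      using row0[OF that kl(2)] l that by blast
    \<comment> \<open>Row \<open>k\<close> vanishes in the old pivot columns and column
      \<open>l\<close> in the old pivot rows, so pivoting at \<open>(k, l)\<close> does not disturb
      what is already cleared.\<close>
    define H where "H = mat p m (\<lambda>(i, j). if i = k \<or> j = l then if i = k \<and> j = l then e else 0
      else G $$ (i, j) - G $$ (i, l) * G $$ (k, j) / e)"
    have "oequiv p m G H"
      unfolding H_def
    proof (rule oequiv_pivot[OF G kl(1,2,4,5)])
      \<comment> \<open>The pivot column is zero in the old pivot rows; its other nonzero entries
        lie in \<open>E\<close>.\<close>
      show "G $$ (i, l) / e \<in> V" if "i < p" for i
        using Gl[of i] e(2)[of "G $$ (i, l)"] kl that
        by (cases "i \<in> I \<or> G $$ (i, l) = 0") (auto simp: E_def)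
      show "G $$ (k, j) / e \<in> V" if "j < m" for j
        using e(2)[of "G $$ (k, j)"] kl that by (cases "G $$ (k, j) = 0") (auto simp: E_def)
    qed
    moreover have "\<exists>I \<sigma> d. monomial_data p m I \<sigma> d \<and> oequiv p m H (monomial_mat p m I \<sigma> d)"
    proof (rule less.hyps)
      have "card (insert k I) \<le> card {..<p}"
        by (rule card_mono) (use I kl in auto)
      then show "p - card (insert k I) < p - card I"
        using kl fI by simp
      show "H \<in> carrier_mat p m" by (simp add: H_def)
      have lt: "i < p" "\<sigma> i < m" if "i \<in> I" for i using I that by auto
      have 1: "H $$ (i, j) = (if j = \<sigma> i then G $$ (i, j) else 0)" if "i \<in> I" "j < m" for i j
        using that lt[of i] kl Gl[of i] row0[of i j] l[of i] by (auto simp: H_def)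
      have 2: "H $$ (i, \<sigma> j) = (if i = j then G $$ (i, \<sigma> j) else 0)" if "j \<in> I" "i < p" for i j
        using that lt[of j] kl \<sigma>k[of j] col0[of j i] l[of j] Gl[of j] by (auto simp: H_def)
      have 3: "H $$ (k, j) = (if j = l then e else 0)" if "j < m" for j
        using that kl by (auto simp: H_def)
      have 4: "H $$ (i, l) = (if i = k then e else 0)" if "i < p" for i
        using that kl by (auto simp: H_def)
      show "cleared p m (insert k I) (\<sigma>(k := l)) H"
        unfolding cleared_def monomial_data_def
      proof (intro conjI ballI allI impI)
        show "inj_on (\<sigma>(k := l)) (insert k I)"
          using I(3) kl l by (auto simp: inj_on_def)
        show "(\<sigma>(k := l)) ` insert k I \<subseteq> {..<m}"
          using I(2) kl by auto
      qed (use I kl 1 2 3 4 lt in \<open>auto split: if_splits\<close>)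
    qed
    ultimately show ?thesis
      using oequiv_trans by blast
  qed
qed

theorem oequiv_monomial_exists:
  assumes "G \<in> carrier_mat p m"
  shows "\<exists>I \<sigma> d. monomial_data p m I \<sigma> d \<and> oequiv p m G (monomial_mat p m I \<sigma> d)"
  using oequiv_monomial_of_cleared[OF assms, of "{}" id] by (simp add: cleared_def monomial_data_def)

section \<open>Uniqueness: counting the pivots that divide a given element\<close>

text \<open>The easy direction of the Frobenius-Koenig theorem: for reasons of cardinality no
  permutation maps \<open>Z\<close> into the complement of \<open>J\<close>, so each term of the
  Leibniz expansion has a factor in the maximal ideal, and so does the whole sum belong to
  it.\<close>

lemma det_zero_block:
  assumes Q: "Q \<in> omat n n" and Z: "Z \<subseteq> {..<n}" and J: "J \<subseteq> {..<n}" and card: "n < card Z + card J"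
    and ZJ: "\<And>i j. i \<in> Z \<Longrightarrow> j \<in> J \<Longrightarrow> Q $$ (i, j) \<in> nonunits"
  shows "det Q \<in> nonunits"
proof -
  have "signof \<pi> * (\<Prod>i = 0..<n. Q $$ (i, \<pi> i)) \<in> nonunits" if \<pi>: "\<pi> permutes {0..<n}" for \<pi>
  proof -
    have "\<exists>i\<in>Z. \<pi> i \<in> J"
    proof (rule ccontr)
      assume "\<not> ?thesis"
      then have "\<pi> ` Z \<subseteq> {..<n} - J"
        using \<pi> Z permutes_in_image[OF \<pi>] by (fastforce simp: lessThan_atLeast0)
      then have "card (\<pi> ` Z) \<le> n - card J"
        using card_mono[of "{..<n} - J" "\<pi> ` Z"] J by (simp add: card_Diff_subset finite_subset)
      moreover have "card (\<pi> ` Z) = card Z"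
        using permutes_inj_on[OF \<pi>] by (rule card_image)
      moreover have "card J \<le> n"
        using card_mono[OF _ J] by simp
      ultimately show False using card by linarith
    qed
    then obtain k where k: "k \<in> Z" "\<pi> k \<in> J" by auto
    then have kn: "k \<in> {0..<n}" using Z by auto
    have "Q $$ (i, \<pi> i) \<in> V" if "i \<in> {0..<n}" for i
      using omat_index[OF Q] that permutes_in_image[OF \<pi>, of i] by auto
    then have "Q $$ (k, \<pi> k) * (\<Prod>i \<in> {0..<n} - {k}. Q $$ (i, \<pi> i)) \<in> nonunits"
      using k by (intro nonunits_mult ZJ) auto
    then have "(\<Prod>i = 0..<n. Q $$ (i, \<pi> i)) \<in> nonunits"
      using prod.remove[OF _ kn, of "\<lambda>i. Q $$ (i, \<pi> i)"] by simp
    from nonunits_mult[OF this, of "signof \<pi>"] show ?thesis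
      by (simp add: sign_def mult.commute)
  qed
  then show ?thesis
    unfolding det_def'[OF omat_carrier[OF Q]] by (intro nonunits_sum) auto
qed

lemma omat_det: "Q \<in> omat n n \<Longrightarrow> det Q \<in> V"
  unfolding det_def'[OF omat_carrier]
  by (intro sum_in mult_in prod_in) (auto simp: sign_def omat_def dest: permutes_in_image)

lemma gl_det:
  assumes "Q \<in> gl n"
  shows "det Q \<in> V" "det Q \<notin> nonunits" "det Q \<noteq> 0" "inverse (det Q) \<in> V"
proof -
  obtain Q' where Q': "Q' \<in> gl n" "Q * Q' = 1\<^sub>m n" using assms by (rule glE)
  have d: "det Q * det Q' = 1"
    using det_mult[OF gl_carrier[OF assms] gl_carrier[OF Q'(1)]] Q'(2) by simp
  show 1: "det Q \<in> V" using assms by (intro omat_det gl_omat)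
  have 2: "det Q' \<in> V" using Q' by (intro omat_det gl_omat)
  show "det Q \<notin> nonunits" using nonunits_mult[OF _ 2, of "det Q"] d one_notin_nonunits by auto
  show "det Q \<noteq> 0" using d by auto
  show "inverse (det Q) \<in> V" using d 2 inverse_unique[OF d] by simp
qed

text \<open>Cofactors of an integral matrix are integral, so the adjugate divided by a unit
  determinant is an integral inverse.\<close>

lemma gl_of_det:
  assumes Q: "Q \<in> omat n n" and d: "det Q \<noteq> 0" "inverse (det Q) \<in> V"
  shows "Q \<in> gl n"
proof (rule glI[OF Q])
  note adj = adj_mat[OF omat_carrier[OF Q]]
  have "cofactor Q j i \<in> V" if "i < n" "j < n" for i j
  proof -
    have "mat_delete Q j i \<in> omat (n - 1) (n - 1)"
      using Q that by (auto simp: omat_def mat_delete_def)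
    then have "det (mat_delete Q j i) \<in> V" by (rule omat_det)
    moreover have "(-1) ^ k \<in> V" for k
      by (induction k) auto
    ultimately show ?thesis by (auto simp: cofactor_def)
  qed
  then have "adj_mat Q \<in> omat n n"
    using omat_carrier[OF Q] by (auto simp: omat_def adj_mat_def)
  then show "inverse (det Q) \<cdot>\<^sub>m adj_mat Q \<in> omat n n"
    using d by (auto simp: omat_def)
  show "Q * (inverse (det Q) \<cdot>\<^sub>m adj_mat Q) = 1\<^sub>m n"
    using adj d omat_carrier[OF Q] by (subst mult_smult_distrib[of _ n n _ n]) (auto)
  show "inverse (det Q) \<cdot>\<^sub>m adj_mat Q * Q = 1\<^sub>m n"
    using adj d omat_carrier[OF Q] by (subst mult_smult_assoc_mat[of _ n n _ n]) (auto)
qed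

text \<open>Read \<open>e / d i \<in> V\<close> as: \<open>d i\<close> divides \<open>e\<close>.
  With \<open>e\<close> running through the powers of a uniformizer these counts recover the
  multiplicity of every exponent.\<close>

lemma card_divisors_le:
  assumes eq: "oequiv p m (monomial_mat p m I \<sigma> d) (monomial_mat p m I' \<sigma>' d')"
    and D: "monomial_data p m I \<sigma> d" and D': "monomial_data p m I' \<sigma>' d'" and e: "e \<noteq> 0"
  shows "card {i \<in> I. e / d i \<in> V} \<le> card {i \<in> I'. e / d' i \<in> V}"
proof (rule ccontr)
  \<comment> \<open>\<open>?Z\<close> also contains the rows outside \<open>I'\<close>, in which the
    second monomial matrix is zero. Hence \<open>card ?Z\<close> is \<open>p\<close> minus the
    second count, and a larger first count gives \<open>card ?Z + card ?J > p\<close>.\<close>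
  let ?J = "{i \<in> I. e / d i \<in> V}" and ?Z = "{..<p} - {i \<in> I'. e / d' i \<in> V}"
  assume gt: "\<not> ?thesis"
  obtain Q R where Q: "Q \<in> gl p" and R: "R \<in> gl m" and QR: "Q * monomial_mat p m I \<sigma> d = monomial_mat p m I' \<sigma>' d' * R"
    using eq by (rule oequivE)
  have J': "{i \<in> I'. e / d' i \<in> V} \<subseteq> {..<p}" using D' by (auto simp: monomial_data_def)
  have "det Q \<in> nonunits"
  proof (rule det_zero_block[OF gl_omat[OF Q]])
    show "?Z \<subseteq> {..<p}" by auto
    show "?J \<subseteq> {..<p}" using D by (auto simp: monomial_data_def)
    show "p < card ?Z + card ?J"
      using gt J' card_mono[OF _ J'] by (simp add: card_Diff_subset finite_subset[OF J'])
    fix i a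
    assume i: "i \<in> ?Z" and a: "a \<in> ?J"
    have ad: "d a \<noteq> 0" "\<sigma> a < m" "a < p" using D a by (auto simp: monomial_data_def)
    have Qd: "Q $$ (i, a) * d a = (if i \<in> I' then d' i * R $$ (\<sigma>' i, \<sigma> a) else 0)"
      using mult_monomial_mat_index[OF gl_carrier[OF Q] D, of i a] monomial_mat_mult_index[OF gl_carrier[OF R] D', of i "\<sigma> a"]
        QR i a ad by simp
    have Qi: "Q $$ (i, a) \<in> V" using omat_index[OF gl_omat[OF Q]] i ad by auto
    show "Q $$ (i, a) \<in> nonunits"
    proof (rule ccontr)
      assume "Q $$ (i, a) \<notin> nonunits"
      then have u: "Q $$ (i, a) \<noteq> 0" "inverse (Q $$ (i, a)) \<in> V"
        using Qi by (auto simp: nonunits_def)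
      then have iI: "i \<in> I'" and eqd: "Q $$ (i, a) * d a = d' i * R $$ (\<sigma>' i, \<sigma> a)"
        using Qd ad by (auto split: if_splits)
      then have i': "d' i \<noteq> 0" "\<sigma>' i < m" using D' by (auto simp: monomial_data_def)
      have "R $$ (\<sigma>' i, \<sigma> a) \<in> V" using omat_index[OF gl_omat[OF R]] i' ad by auto
      moreover have "R $$ (\<sigma>' i, \<sigma> a) \<noteq> 0" using eqd u ad by auto
      \<comment> \<open>If the entry of \<open>Q\<close> were a unit, \<open>d' i\<close> would
        divide \<open>d a\<close> and thus \<open>e\<close>, against the choice of the row.\<close>
      then have "e / d' i = (e / d a) * (R $$ (\<sigma>' i, \<sigma> a) * inverse (Q $$ (i, a)))"
        using eqd u i' ad by (simp add: field_simps)
      moreover have "(e / d a) * (R $$ (\<sigma>' i, \<sigma> a) * inverse (Q $$ (i, a))) \<in> V"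
        using a u calculation(1) by (intro mult_in) auto
      ultimately have "e / d' i \<in> V" by metis
      then show False using i iI by auto
    qed
  qed
  then show False using gl_det[OF Q] by simp
qed

lemma card_divisors_eq:
  assumes "oequiv p m (monomial_mat p m I \<sigma> d) (monomial_mat p m I' \<sigma>' d')"
    and "monomial_data p m I \<sigma> d" and "monomial_data p m I' \<sigma>' d'" and "e \<noteq> 0"
  shows "card {i \<in> I. e / d i \<in> V} = card {i \<in> I'. e / d' i \<in> V}"
  using card_divisors_le[OF assms] card_divisors_le[OF oequiv_sym[OF assms(1)] assms(3,2,4)] by simp

lemma perm_mat_gl:
  assumes "bij_betw \<pi> {..<n} {..<n}"
  shows "perm_mat n \<pi> \<in> gl n"
proof -
  define \<rho> where "\<rho> = the_inv_into {..<n} \<pi>"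
  have \<rho>: "\<rho> i < n" "\<pi> (\<rho> i) = i" "\<pi> i < n" "\<rho> (\<pi> i) = i" if "i < n" for i
    using that assms bij_betw_the_inv_into[OF assms] f_the_inv_into_f_bij_betw[OF assms]
      the_inv_into_f_f[of \<pi> "{..<n}"]
    by (auto simp: \<rho>_def bij_betw_def)
  show ?thesis
  proof (rule glI)
    show "perm_mat n \<pi> \<in> omat n n" "perm_mat n \<rho> \<in> omat n n"
      by (auto simp: perm_mat_def omat_def)
    show "perm_mat n \<pi> * perm_mat n \<rho> = (1\<^sub>m n :: 'k mat)"
    proof (rule eq_matI)
      fix i j assume "i < dim_row (1\<^sub>m n :: 'k mat)" "j < dim_col (1\<^sub>m n :: 'k mat)"
      then show "(perm_mat n \<pi> * perm_mat n \<rho>) $$ (i, j) = (1\<^sub>m n :: 'k mat) $$ (i, j)"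
        using \<rho> by (subst perm_mat_mult_index[of _ n n]) (auto simp: perm_mat_def)
    qed (auto simp: perm_mat_def)
    show "perm_mat n \<rho> * perm_mat n \<pi> = (1\<^sub>m n :: 'k mat)"
    proof (rule eq_matI)
      fix i j assume "i < dim_row (1\<^sub>m n :: 'k mat)" "j < dim_col (1\<^sub>m n :: 'k mat)"
      then show "(perm_mat n \<rho> * perm_mat n \<pi>) $$ (i, j) = (1\<^sub>m n :: 'k mat) $$ (i, j)"
        using \<rho> by (subst perm_mat_mult_index[of _ n n]) (auto simp: perm_mat_def)
    qed (auto simp: perm_mat_def)
  qed
qed

lemma oequiv_permute:
  assumes X: "X \<in> carrier_mat p m" and \<pi>: "bij_betw \<pi> {..<p} {..<p}" and \<rho>: "bij_betw \<rho> {..<m} {..<m}"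
  shows "oequiv p m (mat p m (\<lambda>(i, j). X $$ (\<pi> i, \<rho> j))) X"
proof (rule oequivI[OF X perm_mat_gl[OF \<pi>] gl_transpose[OF perm_mat_gl[OF \<rho>]]])
  show "mat p m (\<lambda>(i, j). X $$ (\<pi> i, \<rho> j)) = perm_mat p \<pi> * X * transpose_mat (perm_mat m \<rho>)"
  proof (rule eq_matI)
    fix i j
    assume "i < dim_row (perm_mat p \<pi> * X * transpose_mat (perm_mat m \<rho>) :: 'k mat)"
      "j < dim_col (perm_mat p \<pi> * X * transpose_mat (perm_mat m \<rho>) :: 'k mat)"
    then have ij: "i < p" "j < m" by (auto simp: perm_mat_def)
    then have \<pi>\<rho>: "\<pi> i < p" "\<rho> j < m" using \<pi> \<rho> by (auto simp: bij_betw_def)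
    show "mat p m (\<lambda>(i, j). X $$ (\<pi> i, \<rho> j)) $$ (i, j)
        = (perm_mat p \<pi> * X * transpose_mat (perm_mat m \<rho>)) $$ (i, j)"
      using ij \<pi>\<rho> mult_carrier_mat[OF perm_mat_carrier X] perm_mat_mult_index[of X p m i \<pi> "\<rho> j"]
        mult_transpose_perm_mat_index[of "perm_mat p \<pi> * X" p m i j \<rho>] X
      by (simp del: index_mult_mat(1))
  qed (auto simp: perm_mat_def)
qed

text \<open>This ties the number of pivots to the length demanded of a list of invariant orders. The
  factor \<open>R\<close> does not change the column space, and the columns of \<open>L\<close>
  times the monomial matrix are zero or nonzero multiples of the independent columns of
  \<open>L\<close> with index in \<open>I\<close>.\<close>

lemma rank_oequiv_monomial:
  assumes eq: "oequiv p m G (monomial_mat p m I \<sigma> d)" and D: "monomial_data p m I \<sigma> d"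
  shows "vec_space.rank p G = card I"
proof -
  interpret vec_space "TYPE('k)" p .
  obtain L R R' where L: "L \<in> gl p" and R: "R \<in> gl m" "R' \<in> gl m" "R * R' = 1\<^sub>m m" and G: "G = L * monomial_mat p m I \<sigma> d * R"
    using eq by (rule oequivE)
  note c = gl_carrier[OF L] gl_carrier[OF R(1)] gl_carrier[OF R(2)] oequiv_carrier[OF eq, THEN conjunct1]
  have fI: "finite I" using D finite_subset by (auto simp: monomial_data_def)
  let ?N = "L * monomial_mat p m I \<sigma> d"
  have N: "?N \<in> carrier_mat p m" using c by simp
  let ?S = "col L ` I"
  have "set (cols ?N) \<subseteq> carrier_vec p" using cols_dim[of ?N] carrier_matD(1)[OF N] by metis
  have Sc: "?S \<subseteq> set (cols L)"
    using c D by (auto simp: monomial_data_def cols_def)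
  have SL: "?S \<subseteq> carrier_vec p" using c(1) by auto
  have rank_L: "rank L = p" using low_rank_det_zero[OF c(1)] gl_det[OF L] by simp
  have dist: "distinct (cols L)" using non_distinct_low_rank[OF c(1)] rank_L by auto
  have "lin_indpt (set (cols L))" using full_rank_lin_indpt[OF c(1) rank_L dist] .
  then have indS: "lin_indpt ?S" using subset_li_is_li Sc by blast
  have "inj_on (col L) I"
  proof (rule inj_onI)
    fix i j assume "i \<in> I" "j \<in> I" "col L i = col L j"
    then show "i = j"
      using nth_eq_iff_index_eq[OF dist, of i j] c(1) D by (auto simp: monomial_data_def subset_iff)
  qed
  then have cardS: "card ?S = card I" by (rule card_image)
  have lt: "i < p" "\<sigma> i < m" if "i \<in> I" for i
    using that D by (auto simp: monomial_data_def)
  have colN: "col ?N (\<sigma> i) = d i \<cdot>\<^sub>v col L i" if "i \<in> I" for i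
    using that c(1) N lt[OF that]
    by (intro eq_vecI) (auto simp: mult_monomial_mat_index[OF c(1) D] mult.commute simp del: index_mult_mat(1))
  have colN0: "col ?N j = 0\<^sub>v p" if "j < m" "j \<notin> \<sigma> ` I" for j
    using that c(1) N
    by (intro eq_vecI) (auto simp: mult_monomial_mat_index_outside[OF c(1)] simp del: index_mult_mat(1))
  have "span (set (cols ?N)) = span ?S"
  proof (rule antisym; rule span_subsetI)
    show "set (cols ?N) \<subseteq> span ?S"
    proof
      fix v assume "v \<in> set (cols ?N)"
      then obtain j where j: "j < m" "v = col ?N j" using N by (auto simp: cols_def)
      show "v \<in> span ?S"
      proof (cases "j \<in> \<sigma> ` I")
        case True
        then obtain i where "i \<in> I" "v = d i \<cdot>\<^sub>v col L i" using colN j by auto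
        then show ?thesis using smult_in_span[OF SL] span_mem[OF SL] by auto
      next
        case False
        then show ?thesis using colN0[OF j(1)] j(2) by (intro in_spanI[of _ "\<lambda>_. 0" "{}"]) (auto simp: lincomb_def)
      qed
    qed
    show "?S \<subseteq> span (set (cols ?N))"
    proof
      fix v assume "v \<in> ?S"
      then obtain i where i: "i \<in> I" "v = col L i" by auto
      then have di: "d i \<noteq> 0" "\<sigma> i < m" using D by (auto simp: monomial_data_def)
      have "v = inverse (d i) \<cdot>\<^sub>v col ?N (\<sigma> i)"
        using di i colN by (simp add: smult_smult_assoc)
      moreover have "col ?N (\<sigma> i) \<in> set (cols ?N)" using N di by (auto simp: cols_def)
      ultimately show "v \<in> span (set (cols ?N))"
        using smult_in_span[of "set (cols ?N)"] span_mem[of "set (cols ?N)"] \<open>set (cols ?N) \<subseteq> carrier_vec p\<close> by auto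
    qed
  qed fact+
  moreover have "span (set (cols G)) = span (set (cols ?N))"
  proof -
    have 1: "G *\<^sub>v v = ?N *\<^sub>v (R *\<^sub>v v)" if "v \<in> carrier_vec m" for v
      unfolding G using that N c by (intro assoc_mult_mat_vec) auto
    have 2: "?N *\<^sub>v v = G *\<^sub>v (R' *\<^sub>v v)" if "v \<in> carrier_vec m" for v
    proof -
      have "G * R' = ?N * (R * R')" unfolding G using N c by (intro assoc_mult_mat) auto
      then have "G * R' = ?N" using R N by simp
      then show ?thesis using assoc_mult_mat_vec[of G p m R' m v] c that by simp
    qed
    have "(\<exists>v\<in>carrier_vec m. G *\<^sub>v v = y) \<longleftrightarrow> (\<exists>v\<in>carrier_vec m. ?N *\<^sub>v v = y)" for y
      using 1 2 mult_mat_vec_carrier[OF c(2)] mult_mat_vec_carrier[OF c(3)] by metis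
    then have "col_space G = col_space ?N"
      unfolding col_space_eq[OF N] col_space_eq[OF c(4)]
      using carrier_matD[OF c(4)] carrier_matD[OF N] by simp
    then show ?thesis by (simp add: col_space_def)
  qed
  moreover have "vectorspace.dim class_ring (span_vs ?S) = card ?S"
    by (rule dim_span) (use SL fI indS in \<open>auto simp: maximal_def\<close>)
  ultimately show ?thesis
    by (simp add: rank_def cardS)
qed

end

section \<open>Invariant orders\<close>

abbreviation uniformizer :: "'a::field \<Rightarrow> 'a poly fract" where
  "uniformizer l \<equiv> to_fract [:-l, 1:]"

definition local_ring :: "'a::field \<Rightarrow> 'a poly fract set" where
  "local_ring l = {f. \<not> has_pole_at f l}"

lemma not_has_pole_at_iff: "\<not> has_pole_at f l \<longleftrightarrow> f \<in> local_ring l"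
  by (simp add: local_ring_def)

lemma mem_loc_iff: "f \<in> local_ring l \<longleftrightarrow> (\<exists>a b. f = to_fract a / to_fract b \<and> poly b l \<noteq> 0)"
  by (auto simp: local_ring_def has_pole_at_def Fract_conv_to_fract)

lemma to_fract_in_loc [simp, intro]: "to_fract a \<in> local_ring l"
  unfolding mem_loc_iff by (rule exI[of _ a], rule exI[of _ 1]) simp

lemma inverse_to_fract_in_loc: "poly b l \<noteq> 0 \<Longrightarrow> inverse (to_fract b) \<in> local_ring l"
  unfolding mem_loc_iff by (rule exI[of _ 1], rule exI[of _ b]) (simp add: inverse_eq_divide)

lemma uniformizer_nonzero [simp]: "uniformizer l \<noteq> 0"
  by simp

text \<open>The exponent is the multiplicity of the root \<open>l\<close> in the numerator minus
  that in the denominator; the cofactors do not vanish at \<open>l\<close> and form the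
  unit.\<close>

lemma loc_factorization:
  fixes f :: "'a::field poly fract"
  assumes "f \<noteq> 0"
  obtains u v where "f = u * uniformizer l powi v" "u \<in> local_ring l" "inverse u \<in> local_ring l" "u \<noteq> 0"
proof -
  have poly_fact: "\<exists>k c. q = [:-l, 1:] ^ k * c \<and> poly c l \<noteq> 0" if "q \<noteq> 0" for q :: "'a poly"
    using order_decomp[OF that, of l] by (auto simp: poly_eq_0_iff_dvd)
  obtain a b where ab: "f = Fract a b" "b \<noteq> 0"
    by (cases f) auto
  then have "a \<noteq> 0"
    using assms by (auto simp: Fract_conv_to_fract)
  obtain j a' where a': "a = [:-l, 1:] ^ j * a'" "poly a' l \<noteq> 0"
    using poly_fact[OF \<open>a \<noteq> 0\<close>] by blast
  obtain k b' where b': "b = [:-l, 1:] ^ k * b'" "poly b' l \<noteq> 0"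
    using poly_fact[OF \<open>b \<noteq> 0\<close>] by blast
  have nz: "a' \<noteq> 0" "b' \<noteq> 0" using a' b' by auto
  have pw: "to_fract ([:-l, 1:] ^ i) = uniformizer l ^ i" for i
    by (induction i) (simp_all only: power_Suc power_0 to_fract_mult to_fract_1)
  show ?thesis
  proof (rule that[of "to_fract a' / to_fract b'" "int j - int k"])
    show "f = to_fract a' / to_fract b' * uniformizer l powi (int j - int k)"
      unfolding ab(1) Fract_conv_to_fract a'(1) b'(1)
      by (simp add: pw power_int_diff mult.commute del: to_fract_eq_0_iff)
    show "to_fract a' / to_fract b' \<in> local_ring l" "inverse (to_fract a' / to_fract b') \<in> local_ring l"
      using a'(2) b'(2) by (auto simp: mem_loc_iff)
    show "to_fract a' / to_fract b' \<noteq> 0" using nz by simp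
  qed
qed

lemma loc_mult: "f \<in> local_ring l \<Longrightarrow> g \<in> local_ring l \<Longrightarrow> f * g \<in> local_ring l"
proof -
  assume "f \<in> local_ring l" "g \<in> local_ring l"
  then obtain a b c d where "f = to_fract a / to_fract b" "poly b l \<noteq> 0" "g = to_fract c / to_fract d" "poly d l \<noteq> 0"
    unfolding mem_loc_iff by blast
  then show ?thesis
    unfolding mem_loc_iff by (intro exI[of _ "a * c"] exI[of _ "b * d"]) simp
qed

lemma loc_add: "f \<in> local_ring l \<Longrightarrow> g \<in> local_ring l \<Longrightarrow> f + g \<in> local_ring l"
proof -
  assume "f \<in> local_ring l" "g \<in> local_ring l"
  then obtain a b c d where *: "f = to_fract a / to_fract b" "poly b l \<noteq> 0" "g = to_fract c / to_fract d" "poly d l \<noteq> 0"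
    unfolding mem_loc_iff by blast
  then have "b \<noteq> 0" "d \<noteq> 0" by auto
  with * show ?thesis
    unfolding mem_loc_iff by (intro exI[of _ "a * d + c * b"] exI[of _ "b * d"]) (simp add: add_frac_eq)
qed

lemma power_uniformizer_in_loc: "v \<ge> 0 \<Longrightarrow> uniformizer l powi v \<in> local_ring l"
proof -
  assume "v \<ge> 0"
  moreover have "uniformizer l ^ k \<in> local_ring l" for k
    by (induction k) (auto intro: loc_mult simp flip: to_fract_1)
  ultimately show ?thesis by (simp add: power_int_def)
qed

interpretation loc: valuation_subring "local_ring l" for l :: "'a::field"
proof
  show "1 \<in> local_ring l" using to_fract_in_loc[of 1 l] by simp
  show "- f \<in> local_ring l" if "f \<in> local_ring l" for f
    using loc_mult[OF to_fract_in_loc[of "-1" l] that] by (simp del: to_fract_uminus add: to_fract_uminus)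
  \<comment> \<open>The sign of the exponent in the factorization decides which of the two is
    integral.\<close>
  show "f \<in> local_ring l \<or> inverse f \<in> local_ring l" for f
  proof (cases "f = 0")
    case False
    then obtain u v where f: "f = u * uniformizer l powi v" "u \<in> local_ring l" "inverse u \<in> local_ring l"
      by (rule loc_factorization)
    have "inverse f = inverse u * uniformizer l powi (- v)"
      using f(1) by (simp add: power_int_minus)
    then show ?thesis
      using f loc_mult power_uniformizer_in_loc[of v l] power_uniformizer_in_loc[of "- v" l]
      by (cases "v \<ge> 0") (auto simp del: inverse_mult_distrib)
  qed (use to_fract_in_loc[of 0 l] in simp)
qed (auto intro: loc_mult loc_add)

lemma inverse_uniformizer_notin_loc: "inverse (uniformizer l) \<notin> local_ring l"
proof
  assume "inverse (uniformizer l) \<in> local_ring l"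
  then obtain a b where ab: "inverse (uniformizer l) = to_fract a / to_fract b" "poly b l \<noteq> 0"
    unfolding mem_loc_iff by blast
  then have "b \<noteq> 0" by auto
  then have "to_fract b = uniformizer l * to_fract a"
    using ab(1) by (simp add: field_simps)
  then have "to_fract b = to_fract ([:-l, 1:] * a)"
    by (simp only: to_fract_mult)
  then have "b = [:-l, 1:] * a" by (simp only: to_fract_eq_iff)
  then have "poly b l = 0" by simp
  then show False using ab(2) by simp
qed

lemma power_uniformizer_in_loc_iff: "uniformizer l powi v \<in> local_ring l \<longleftrightarrow> v \<ge> 0"
proof
  assume v: "uniformizer l powi v \<in> local_ring l"
  show "v \<ge> 0"
  proof (rule ccontr)
    assume "\<not> v \<ge> 0"
    \<comment> \<open>This exponent is nonnegative, and it lifts a negative power of the uniformizer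
      to its inverse, which is not integral.\<close>
    then have "uniformizer l powi (- 1 - v) \<in> local_ring l"
      by (intro power_uniformizer_in_loc) simp
    then have "uniformizer l powi v * uniformizer l powi (- 1 - v) \<in> local_ring l"
      using v by (intro loc_mult)
    then have "uniformizer l powi (- 1) \<in> local_ring l"
      by (simp flip: power_int_add)
    then have "inverse (uniformizer l) \<in> local_ring l"
      by (simp add: power_int_minus)
    then show False
      using inverse_uniformizer_notin_loc[of l] by contradiction
  qed
qed (rule power_uniformizer_in_loc)

text \<open>If f = a / b and 1 / f = c / d with b and d not vanishing at l, then a c = b d, and
  evaluation at l shows that a does not vanish there either. Through this equivalence the regular
  matrices become the group \<open>gl\<close>.\<close>

lemma nonzero_at_iff: "nonzero_at f l \<longleftrightarrow> f \<in> local_ring l \<and> f \<noteq> 0 \<and> inverse f \<in> local_ring l"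
proof
  assume "nonzero_at f l"
  then obtain a b where ab: "f = to_fract a / to_fract b" "poly b l \<noteq> 0" "poly a l \<noteq> 0"
    by (auto simp: nonzero_at_def Fract_conv_to_fract)
  then have "a \<noteq> 0" "b \<noteq> 0" by auto
  with ab show "f \<in> local_ring l \<and> f \<noteq> 0 \<and> inverse f \<in> local_ring l"
    by (auto simp: mem_loc_iff)
next
  assume f: "f \<in> local_ring l \<and> f \<noteq> 0 \<and> inverse f \<in> local_ring l"
  then obtain a b c d where *: "f = to_fract a / to_fract b" "poly b l \<noteq> 0"
      "inverse f = to_fract c / to_fract d" "poly d l \<noteq> 0"
    unfolding mem_loc_iff by blast
  then have nz: "b \<noteq> 0" "d \<noteq> 0" by auto
  have "(to_fract a / to_fract b) * (to_fract c / to_fract d) = 1"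
    using f unfolding *(1,3)[symmetric] by simp
  then have "to_fract (a * c) = to_fract (b * d)"
    using nz by (simp add: field_simps)
  then have "a * c = b * d" by (simp only: to_fract_eq_iff)
  then have "poly a l * poly c l = poly b l * poly d l" by (metis poly_mult)
  then have "poly a l \<noteq> 0" using *(2,4) by auto
  then show "nonzero_at f l"
    unfolding nonzero_at_def using * by (intro exI[of _ a] exI[of _ b]) (simp add: Fract_conv_to_fract)
qed

lemma regular_at_iff_gl:
  assumes "R \<in> carrier_mat n n"
  shows "regular_at R l \<longleftrightarrow> R \<in> loc.gl l n"
proof
  assume "regular_at R l"
  then have "R \<in> loc.omat l n n" "nonzero_at (det R) l"
    using assms by (auto simp: regular_at_def loc.omat_def not_has_pole_at_iff)
  then show "R \<in> loc.gl l n"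
    by (auto simp: nonzero_at_iff intro: loc.gl_of_det)
next
  assume R: "R \<in> loc.gl l n"
  then show "regular_at R l"
    using assms loc.gl_det[OF R] loc.omat_index[OF loc.gl_omat[OF R]]
    by (auto simp: regular_at_def nonzero_at_iff not_has_pole_at_iff)
qed

lemma is_invariant_orders_iff:
  assumes "G \<in> carrier_mat p m"
  shows "is_invariant_orders G l \<nu>s \<longleftrightarrow> sorted \<nu>s \<and> length \<nu>s = vec_space.rank p G \<and>
    loc.oequiv l p m G (local_smith_mat p m l \<nu>s)"
  using assms regular_at_iff_gl[of _ _ l] loc.gl_carrier[of _ l]
  unfolding is_invariant_orders_def loc.oequiv_def
  by (auto simp: local_smith_mat_def) blast

lemma local_smith_mat_eq_monomial_mat:
  "local_smith_mat p m l \<nu>s = monomial_mat p m {..<length \<nu>s} id (\<lambda>i. uniformizer l powi (\<nu>s ! i))"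
  by (rule eq_matI) (auto simp: local_smith_mat_def monomial_mat_def)

lemma monomial_data_smith:
  "length \<nu>s \<le> p \<Longrightarrow> length \<nu>s \<le> m \<Longrightarrow>
   monomial_data p m {..<length \<nu>s} id (\<lambda>i. uniformizer l powi (\<nu>s ! i))"
  by (auto simp: monomial_data_def)

text \<open>Each pivot is a unit times a power of the uniformizer; the units are moved into an
  invertible diagonal matrix on the left.\<close>

lemma oequiv_monomial_powers_exists:
  assumes "G \<in> carrier_mat p m"
  obtains I \<sigma> v where "monomial_data p m I \<sigma> (\<lambda>i. uniformizer l powi v i)"
    "loc.oequiv l p m G (monomial_mat p m I \<sigma> (\<lambda>i. uniformizer l powi v i))"
proof -
  obtain I \<sigma> d where D: "monomial_data p m I \<sigma> d" and eq: "loc.oequiv l p m G (monomial_mat p m I \<sigma> d)"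
    using loc.oequiv_monomial_exists[OF assms] by blast
  have "\<forall>i. \<exists>u v. i \<in> I \<longrightarrow> d i = u * uniformizer l powi v \<and> u \<in> local_ring l \<and> inverse u \<in> local_ring l \<and> u \<noteq> 0"
    using D by (metis loc_factorization monomial_data_def)
  then obtain u v where uv: "\<And>i. i \<in> I \<Longrightarrow> d i = u i * uniformizer l powi v i"
      "\<And>i. i \<in> I \<Longrightarrow> u i \<in> local_ring l \<and> inverse (u i) \<in> local_ring l \<and> u i \<noteq> 0"
    by metis
  \<comment> \<open>The default 1 in rows without pivot keeps the diagonal matrix
    invertible.\<close>
  define w where "w i = (if i \<in> I then u i else 1)" for i
  have w: "w i \<in> local_ring l" "inverse (w i) \<in> local_ring l" "w i \<noteq> 0" for i
    using uv(2)[of i] by (auto simp: w_def)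
  let ?W = "\<lambda>w. monomial_mat p p {..<p} id w" and ?M = "monomial_mat p m I \<sigma> (\<lambda>i. uniformizer l powi v i)"
  have Wd: "monomial_data p p {..<p} id w" "monomial_data p p {..<p} id (\<lambda>i. inverse (w i))"
    using w by (auto simp: monomial_data_def)
  have W: "?W w \<in> loc.gl l p"
  proof (rule loc.glI)
    show "?W w \<in> loc.omat l p p" "?W (\<lambda>i. inverse (w i)) \<in> loc.omat l p p"
      using w by (auto simp: loc.omat_def)
    show "?W w * ?W (\<lambda>i. inverse (w i)) = 1\<^sub>m p"
      by (rule eq_matI) (use w in \<open>auto simp: monomial_mat_mult_index[OF _ Wd(1), of _ p] simp del: index_mult_mat(1)\<close>)
    show "?W (\<lambda>i. inverse (w i)) * ?W w = 1\<^sub>m p"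
      by (rule eq_matI) (use w in \<open>auto simp: monomial_mat_mult_index[OF _ Wd(2), of _ p] simp del: index_mult_mat(1)\<close>)
  qed
  have "monomial_mat p m I \<sigma> d = ?W w * ?M"
    by (rule eq_matI)
      (use uv in \<open>auto simp: monomial_mat_mult_index[OF _ Wd(1), of _ m] w_def simp del: index_mult_mat(1)\<close>)
  then have "loc.oequiv l p m (monomial_mat p m I \<sigma> d) ?M"
    using loc.oequiv_left[OF _ W, of ?M m] by simp
  then have "loc.oequiv l p m G ?M"
    using eq loc.oequiv_trans by blast
  moreover have "monomial_data p m I \<sigma> (\<lambda>i. uniformizer l powi v i)"
    using D by (auto simp: monomial_data_def)
  ultimately show ?thesis using that by blast
qed

text \<open>The pivots dividing the j-th power of the uniformizer are those with exponent at most j.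
  Their numbers agree on both sides for every j, and the multiplicity of k is the difference of the
  numbers for k and k - 1.\<close>

lemma image_mset_orders_unique:
  assumes eq: "loc.oequiv l p m (monomial_mat p m I \<sigma> (\<lambda>i. uniformizer l powi v i))
      (monomial_mat p m I' \<sigma>' (\<lambda>i. uniformizer l powi v' i))"
    and D: "monomial_data p m I \<sigma> (\<lambda>i. uniformizer l powi v i)"
    and D': "monomial_data p m I' \<sigma>' (\<lambda>i. uniformizer l powi v' i)"
  shows "image_mset v (mset_set I) = image_mset v' (mset_set I')"
proof (rule multiset_eqI)
  fix k
  have fin: "finite I" "finite I'"
    using D D' finite_subset by (auto simp: monomial_data_def)
  have le: "uniformizer l powi j / uniformizer l powi i \<in> local_ring l \<longleftrightarrow> i \<le> j" for i j
    by (simp add: power_uniformizer_in_loc_iff flip: power_int_diff)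
  have card_le: "card {i \<in> I. v i \<le> j} = card {i \<in> I'. v' i \<le> j}" for j
    using loc.card_divisors_eq[OF eq D D', of "uniformizer l powi j"] by (simp add: le)
  have count: "count (image_mset w (mset_set J)) k = card {i \<in> J. w i \<le> k} - card {i \<in> J. w i \<le> k - 1}"
    if "finite J" for w :: "nat \<Rightarrow> int" and J
  proof -
    have "count (image_mset w (mset_set J)) k = card {i \<in> J. w i = k}"
      using that by (simp add: count_image_mset' Int_def conj_commute eq_commute[of k])
    also have "{i \<in> J. w i = k} = {i \<in> J. w i \<le> k} - {i \<in> J. w i \<le> k - 1}" by auto
    also have "card \<dots> = card {i \<in> J. w i \<le> k} - card {i \<in> J. w i \<le> k - 1}"
      by (rule card_Diff_subset) (use that in auto)
    finally show ?thesis .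
  qed
  show "count (image_mset v (mset_set I)) k = count (image_mset v' (mset_set I')) k"
    unfolding count[OF fin(1)] count[OF fin(2)] card_le ..
qed

text \<open>The pivot rows, sorted by exponent, are moved to the first rows, and their pivot columns
  to the columns with the same index.\<close>

lemma oequiv_smith_of_monomial:
  assumes D: "monomial_data p m I \<sigma> (\<lambda>i. uniformizer l powi v i)"
  obtains \<nu>s where "sorted \<nu>s" "mset \<nu>s = image_mset v (mset_set I)"
    "loc.oequiv l p m (local_smith_mat p m l \<nu>s) (monomial_mat p m I \<sigma> (\<lambda>i. uniformizer l powi v i))"
proof -
  have I: "I \<subseteq> {..<p}" "\<sigma> ` I \<subseteq> {..<m}" "inj_on \<sigma> I" "finite I"
    using D finite_subset by (auto simp: monomial_data_def)
  define xs where "xs = sort_key v (sorted_list_of_set I)"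
  define \<nu>s where "\<nu>s = map v xs"
  have xs: "set xs = I" "distinct xs" "mset xs = mset_set I"
    using I(4) mset_set_set[of "sorted_list_of_set I"] by (auto simp: xs_def)
  have inj: "inj_on (\<lambda>i. xs ! i) {..<length xs}"
    using xs(2) by (auto simp: inj_on_def nth_eq_iff_index_eq)
  have im: "(\<lambda>i. xs ! i) ` {..<length xs} = I"
    using xs(1) by (auto simp: set_conv_nth)
  obtain \<pi> where \<pi>: "bij_betw \<pi> {..<p} {..<p}" "\<And>i. i < length xs \<Longrightarrow> \<pi> i = xs ! i"
    using extend_to_permutation[OF inj, of p] im I(1) by auto
  have inj': "inj_on (\<sigma> \<circ> (\<lambda>i. xs ! i)) {..<length xs}"
    using comp_inj_on[OF inj, of \<sigma>] I(3) im by simp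
  moreover have "(\<sigma> \<circ> (\<lambda>i. xs ! i)) ` {..<length xs} \<subseteq> {..<m}"
    using I(2) im by (metis image_comp)
  ultimately obtain \<rho> where \<rho>: "bij_betw \<rho> {..<m} {..<m}" "\<And>i. i < length xs \<Longrightarrow> \<rho> i = \<sigma> (xs ! i)"
    using extend_to_permutation by (metis comp_apply)
  let ?M = "monomial_mat p m I \<sigma> (\<lambda>i. uniformizer l powi v i)"
  have "card I \<le> m"
    using card_mono[OF _ I(2)] card_image[OF I(3)] by simp
  then have len: "length xs \<le> m"
    using distinct_card[OF xs(2)] xs(1) by simp
  have "local_smith_mat p m l \<nu>s = mat p m (\<lambda>(i, j). ?M $$ (\<pi> i, \<rho> j))"
  proof (rule eq_matI)
    fix i j
    assume "i < dim_row (mat p m (\<lambda>(i, j). ?M $$ (\<pi> i, \<rho> j)))" "j < dim_col (mat p m (\<lambda>(i, j). ?M $$ (\<pi> i, \<rho> j)))"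
    then have ij: "i < p" "j < m" by auto
    then have \<pi>\<rho>: "\<pi> i < p" "\<rho> j < m" using \<pi>(1) \<rho>(1) by (auto simp: bij_betw_def)
    \<comment> \<open>All of \<open>I\<close> is already taken as values below
      \<open>length xs\<close>, so injectivity of \<open>\<pi>\<close> keeps later rows out of
      \<open>I\<close>.\<close>
    have "\<pi> i \<in> I \<longleftrightarrow> i < length xs"
    proof
      assume "\<pi> i \<in> I"
      then obtain k where "k < length xs" "\<pi> i = \<pi> k" using im \<pi>(2) by auto
      moreover have "k < p" if "k < length xs" for k
        using that card_mono[OF _ I(1)] distinct_card[OF xs(2)] xs(1) by simp
      ultimately show "i < length xs"
        using \<pi>(1) ij by (auto simp: bij_betw_def inj_on_def)
    qed (use \<pi>(2) xs(1) in auto)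
    moreover have "\<rho> j = \<sigma> (\<pi> i) \<longleftrightarrow> j = i" if "i < length xs"
    proof -
      have "\<sigma> (\<pi> i) = \<rho> i" using that \<pi>(2) \<rho>(2) by simp
      then show ?thesis using \<rho>(1) ij that len by (auto simp: bij_betw_def inj_on_def)
    qed
    ultimately show "local_smith_mat p m l \<nu>s $$ (i, j) = mat p m (\<lambda>(i, j). ?M $$ (\<pi> i, \<rho> j)) $$ (i, j)"
      using ij \<pi>\<rho> \<pi>(2)[of i] by (auto simp: local_smith_mat_def \<nu>s_def)
  qed (auto simp: local_smith_mat_def)
  moreover have "loc.oequiv l p m (mat p m (\<lambda>(i, j). ?M $$ (\<pi> i, \<rho> j))) ?M"
    by (rule loc.oequiv_permute[OF _ \<pi>(1) \<rho>(1)]) simp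
  moreover have "sorted \<nu>s" by (simp add: \<nu>s_def xs_def)
  moreover have "mset \<nu>s = image_mset v (mset_set I)" by (simp add: \<nu>s_def xs(3))
  ultimately show ?thesis using that by metis
qed

text \<open>Resolves the definite description: any monomial form with powers as pivots determines
  the invariant orders, whatever the positions of its pivots.\<close>

lemma is_invariant_orders_of_monomial:
  assumes D: "monomial_data p m I \<sigma> (\<lambda>i. uniformizer l powi v i)"
    and eq: "loc.oequiv l p m G (monomial_mat p m I \<sigma> (\<lambda>i. uniformizer l powi v i))"
  shows "is_invariant_orders G l (invariant_orders G l)" "mset (invariant_orders G l) = image_mset v (mset_set I)"
proof -
  let ?M = "monomial_mat p m I \<sigma> (\<lambda>i. uniformizer l powi v i)"
  note G = loc.oequiv_carrier[OF eq, THEN conjunct1]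
  have I: "I \<subseteq> {..<p}" "\<sigma> ` I \<subseteq> {..<m}" "inj_on \<sigma> I" "finite I"
    using D finite_subset by (auto simp: monomial_data_def)
  have rank: "vec_space.rank p G = card I" by (rule loc.rank_oequiv_monomial[OF eq D])
  have card: "card I \<le> p" "card I \<le> m"
    using card_mono[OF _ I(1)] card_mono[OF _ I(2)] card_image[OF I(3)] by simp_all
  have uniq: "mset \<nu>s = image_mset v (mset_set I)" if \<nu>s: "is_invariant_orders G l \<nu>s" for \<nu>s
  proof -
    have len: "length \<nu>s = card I" and eq': "loc.oequiv l p m G (local_smith_mat p m l \<nu>s)"
      using \<nu>s rank unfolding is_invariant_orders_iff[OF G] by simp_all
    \<comment> \<open>The rank fixes the length as \<open>card I\<close>, so the list fits into the
      matrix and \<open>local_smith_mat\<close> cuts off no exponent.\<close>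
    have Ds: "monomial_data p m {..<length \<nu>s} id (\<lambda>i. uniformizer l powi (\<nu>s ! i))"
      by (rule monomial_data_smith) (use len card in simp_all)
    have "image_mset (\<lambda>i. \<nu>s ! i) (mset_set {..<length \<nu>s}) = image_mset v (mset_set I)"
      using loc.oequiv_trans[OF loc.oequiv_sym[OF eq'] eq] Ds D
      unfolding local_smith_mat_eq_monomial_mat by (rule image_mset_orders_unique)
    moreover have "mset \<nu>s = mset (map (\<lambda>i. \<nu>s ! i) [0..<length \<nu>s])"
      by (simp only: map_nth)
    then have "mset \<nu>s = image_mset (\<lambda>i. \<nu>s ! i) (mset_set {..<length \<nu>s})"
      by (simp only: mset_map mset_upt lessThan_atLeast0)
    ultimately show ?thesis by (rule trans[rotated])
  qed
  obtain \<nu>s where \<nu>s: "sorted \<nu>s" "mset \<nu>s = image_mset v (mset_set I)"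
    "loc.oequiv l p m (local_smith_mat p m l \<nu>s) ?M"
    using D by (rule oequiv_smith_of_monomial)
  have "length \<nu>s = card I" using arg_cong[OF \<nu>s(2), of size] by simp
  then have ex: "is_invariant_orders G l \<nu>s"
    unfolding is_invariant_orders_iff[OF G] using \<nu>s(1) rank loc.oequiv_trans[OF eq loc.oequiv_sym[OF \<nu>s(3)]] by simp
  \<comment> \<open>Two sorted lists with the same multiset are equal.\<close>
  have "\<nu>s' = \<nu>s" if "is_invariant_orders G l \<nu>s'" for \<nu>s'
    using uniq[OF that] uniq[OF ex] that ex properties_for_sort[of \<nu>s' \<nu>s] sorted_sort_id[of \<nu>s]
    by (simp add: is_invariant_orders_def)
  then show "is_invariant_orders G l (invariant_orders G l)"
    unfolding invariant_orders_def using ex theI[of "is_invariant_orders G l" \<nu>s] by blast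
  then show "mset (invariant_orders G l) = image_mset v (mset_set I)" by (rule uniq)
qed

lemma is_invariant_orders_invariant_orders:
  assumes "G \<in> carrier_mat p m"
  shows "is_invariant_orders G l (invariant_orders G l)"
  using oequiv_monomial_powers_exists[OF assms] is_invariant_orders_of_monomial(1) by metis

lemma oequiv_smith:
  fixes G :: "'a::field poly fract mat" and l :: 'a
  assumes "G \<in> carrier_mat p m"
  defines "\<nu>s \<equiv> invariant_orders G l"
  shows "loc.oequiv l p m G (local_smith_mat p m l \<nu>s)" "length \<nu>s \<le> p" "length \<nu>s \<le> m"
proof -
  show "loc.oequiv l p m G (local_smith_mat p m l \<nu>s)"
    using is_invariant_orders_invariant_orders[OF assms(1)] is_invariant_orders_iff[OF assms(1)] by (simp add: \<nu>s_def)
  obtain I \<sigma> v where D: "monomial_data p m I \<sigma> (\<lambda>i. uniformizer l powi v i)"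
    "loc.oequiv l p m G (monomial_mat p m I \<sigma> (\<lambda>i. uniformizer l powi v i))"
    using assms(1) by (rule oequiv_monomial_powers_exists)
  have "length \<nu>s = card I"
    using arg_cong[OF is_invariant_orders_of_monomial(2)[OF D], of size] by (simp add: \<nu>s_def)
  moreover have "card I \<le> p" "card (\<sigma> ` I) \<le> m" "card (\<sigma> ` I) = card I"
    using D(1) card_mono[of "{..<p}" I] card_mono[of "{..<m}" "\<sigma> ` I"] by (auto simp: monomial_data_def card_image)
  ultimately show "length \<nu>s \<le> p" "length \<nu>s \<le> m" by auto
qed

text \<open>The Smith form arises from an integral matrix by integral transformations, so its
  diagonal powers are integral too.\<close>

lemma invariant_orders_nonneg:
  assumes "G \<in> loc.omat l p m" "\<nu> \<in> set (invariant_orders G l)"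
  shows "\<nu> \<ge> 0"
proof -
  let ?\<nu>s = "invariant_orders G l"
  note s = oequiv_smith[OF loc.omat_carrier[OF assms(1)], of l]
  obtain L' R' where LR: "L' \<in> loc.gl l p" "R' \<in> loc.gl l m" "local_smith_mat p m l ?\<nu>s = L' * G * R'"
    using s(1) by (rule loc.oequivE)
  have om: "local_smith_mat p m l ?\<nu>s \<in> loc.omat l p m"
    unfolding LR(3) by (intro loc.omat_mult) (use LR assms in \<open>auto intro: loc.gl_omat\<close>)
  obtain i where i: "i < length ?\<nu>s" "\<nu> = ?\<nu>s ! i"
    using assms(2) by (auto simp: in_set_conv_nth)
  have "local_smith_mat p m l ?\<nu>s $$ (i, i) \<in> local_ring l"
    by (rule loc.omat_index[OF om]) (use i s in auto)
  then show ?thesis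
    using i s by (simp add: local_smith_mat_def power_uniformizer_in_loc_iff)
qed

section \<open>Local Bezout identities from rank conditions\<close>

interpretation to_fract_hom: comm_ring_hom "to_fract :: 'a::idom \<Rightarrow> 'a fract"
  by unfold_locales auto

interpretation univ: valuation_subring "UNIV :: 'k::field set"
  by unfold_locales auto

text \<open>Over the trivial valuation ring \<open>UNIV\<close> the monomial form is a rank normal
  form. Full column rank means that every column contains a pivot, so the monomial matrix has an
  explicit left inverse.\<close>

lemma full_column_rank_left_inverse:
  fixes M :: "'k::field mat"
  assumes M: "M \<in> carrier_mat p n" and rank: "vec_space.rank p M = n"
  shows "\<exists>X \<in> carrier_mat n p. X * M = 1\<^sub>m n"
proof -
  obtain I \<sigma> d where D: "monomial_data p n I \<sigma> d" and eq: "univ.oequiv p n M (monomial_mat p n I \<sigma> d)"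
    using univ.oequiv_monomial_exists[OF M] by blast
  have "card (\<sigma> ` I) = n"
    using univ.rank_oequiv_monomial[OF eq D] rank D by (simp add: monomial_data_def card_image)
  then have \<sigma>I: "\<sigma> ` I = {..<n}"
    using D by (intro card_subset_eq) (auto simp: monomial_data_def)
  \<comment> \<open>\<open>?Z\<close> is transposed with inverted pivots; it inverts
    \<open>?S\<close> from the left because \<open>\<sigma>\<close> reaches all columns.\<close>
  let ?S = "monomial_mat p n I \<sigma> d" and ?Z = "transpose_mat (monomial_mat p n I \<sigma> (\<lambda>i. inverse (d i)))"
  obtain L L' R R' where LR: "L \<in> univ.gl p" "L' \<in> univ.gl p" "R \<in> univ.gl n" "R' \<in> univ.gl n"
    "L' * L = 1\<^sub>m p" "R' * R = 1\<^sub>m n" "L' * M = ?S * R"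
    using eq by (rule univ.oequivE)
  note c = LR(1-4)[THEN univ.gl_carrier]
  have Z: "?Z \<in> carrier_mat n p" by simp
  have ZS: "?Z * ?S = 1\<^sub>m n"
  proof (rule eq_matI)
    fix i j assume "i < dim_row (1\<^sub>m n :: 'k mat)" "j < dim_col (1\<^sub>m n :: 'k mat)"
    then have ij: "i < n" "j < n" by auto
    then obtain a where a: "a \<in> I" "j = \<sigma> a" using \<sigma>I by auto
    then have "a < p" "d a \<noteq> 0" using D by (auto simp: monomial_data_def)
    then show "(?Z * ?S) $$ (i, j) = 1\<^sub>m n $$ (i, j)"
      unfolding a(2) using mult_monomial_mat_index[OF Z D ij(1) a(1)] ij a by (simp del: index_mult_mat(1))
  qed auto
  have "R' * ?Z * L' * M = R' * ?Z * (L' * M)"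
    by (rule assoc_mult_mat[of _ n p _ p _ n]) (use c M in auto)
  also have "\<dots> = R' * (?Z * (?S * R))"
    unfolding LR(7) by (rule assoc_mult_mat) (use c in auto)
  also have "?Z * (?S * R) = ?Z * ?S * R"
    by (rule assoc_mult_mat[symmetric]) (use c in auto)
  also have "R' * (?Z * ?S * R) = 1\<^sub>m n"
    using ZS c LR by simp
  finally show ?thesis
    using c by (intro bexI[of _ "R' * ?Z * L'"]) (auto intro!: mult_carrier_mat)
qed

text \<open>Now every row contains a pivot, and the transpose with inverted pivots is a right
  inverse.\<close>

lemma full_row_rank_right_inverse:
  fixes M :: "'k::field mat"
  assumes M: "M \<in> carrier_mat n m" and rank: "vec_space.rank n M = n"
  shows "\<exists>X \<in> carrier_mat m n. M * X = 1\<^sub>m n"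
proof -
  obtain I \<sigma> d where D: "monomial_data n m I \<sigma> d" and eq: "univ.oequiv n m M (monomial_mat n m I \<sigma> d)"
    using univ.oequiv_monomial_exists[OF M] by blast
  have "card I = n"
    using univ.rank_oequiv_monomial[OF eq D] rank by simp
  then have I: "I = {..<n}"
    using D by (intro card_subset_eq) (auto simp: monomial_data_def)
  let ?S = "monomial_mat n m I \<sigma> d" and ?Z = "transpose_mat (monomial_mat n m I \<sigma> (\<lambda>i. inverse (d i)))"
  obtain L L' R R' where LR: "L \<in> univ.gl n" "L' \<in> univ.gl n" "R \<in> univ.gl m" "R' \<in> univ.gl m"
    "L * L' = 1\<^sub>m n" "R * R' = 1\<^sub>m m" "M = L * ?S * R"
    using eq by (rule univ.oequivE)
  note c = LR(1-4)[THEN univ.gl_carrier]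
  have Z: "?Z \<in> carrier_mat m n" by simp
  have SZ: "?S * ?Z = 1\<^sub>m n"
  proof (rule eq_matI)
    fix i j assume "i < dim_row (1\<^sub>m n :: 'k mat)" "j < dim_col (1\<^sub>m n :: 'k mat)"
    then have ij: "i < n" "j < n" by auto
    then have "\<sigma> i < m" "d i \<noteq> 0" "\<sigma> i = \<sigma> j \<longleftrightarrow> i = j" using D I by (auto simp: monomial_data_def inj_on_def)
    then show "(?S * ?Z) $$ (i, j) = 1\<^sub>m n $$ (i, j)"
      using monomial_mat_mult_index[OF Z D ij] ij I by (auto simp del: index_mult_mat(1))
  qed auto
  have "M * (R' * ?Z * L') = L * ?S * (R * (R' * ?Z * L'))"
    unfolding LR(7) by (rule assoc_mult_mat) (use c in auto)
  also have "R' * ?Z * L' = R' * (?Z * L')"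
    by (rule assoc_mult_mat) (use c in auto)
  also have "R * (R' * (?Z * L')) = R * R' * (?Z * L')"
    by (rule assoc_mult_mat[symmetric]) (use c in auto)
  also have "\<dots> = ?Z * L'"
    using LR(6) c by simp
  also have "L * ?S * (?Z * L') = L * (?S * (?Z * L'))"
    by (rule assoc_mult_mat) (use c in auto)
  also have "?S * (?Z * L') = ?S * ?Z * L'"
    by (rule assoc_mult_mat[symmetric]) (use c in auto)
  also have "L * (?S * ?Z * L') = 1\<^sub>m n"
    using SZ c LR(5) by simp
  finally show ?thesis
    using c by (intro bexI[of _ "R' * (?Z * L')"]) (auto intro!: mult_carrier_mat)
qed

lemma map_to_fract_omat [simp, intro]:
  "M \<in> carrier_mat n m \<Longrightarrow> map_mat to_fract M \<in> loc.omat l n m"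
  by (auto simp: loc.omat_def)

lemma eval_mat_carrier [simp]: "M \<in> carrier_mat n m \<Longrightarrow> eval_mat M l \<in> carrier_mat n m"
  by (simp add: eval_mat_def)

lemma eval_mat_mult:
  fixes M :: "'a::field poly mat"
  assumes "M \<in> carrier_mat n k" "N \<in> carrier_mat k m"
  shows "eval_mat (M * N) l = eval_mat M l * eval_mat N l"
proof -
  interpret ev: comm_ring_hom "\<lambda>q :: 'a poly. poly q l"
    by unfold_locales auto
  show ?thesis
    unfolding eval_mat_def using assms by (rule ev.mat_hom_mult)
qed

text \<open>The determinant takes the value 1 at the point, hence is a unit of the local
  ring.\<close>

lemma gl_of_eval_eq_one:
  fixes U :: "'a::field poly mat"
  assumes U: "U \<in> carrier_mat n n" and ev: "eval_mat U l = 1\<^sub>m n"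
  shows "map_mat to_fract U \<in> loc.gl l n"
proof -
  interpret ev: comm_ring_hom "\<lambda>q :: 'a poly. poly q l"
    by unfold_locales auto
  have "poly (det U) l = det (eval_mat U l)"
    by (simp add: eval_mat_def)
  then have "poly (det U) l = 1"
    by (simp add: ev)
  then have "poly (det U) l \<noteq> 0" by simp
  then show ?thesis
    using U by (intro loc.gl_of_det) (auto simp: inverse_to_fract_in_loc)
qed

text \<open>Passes from the residue field to the local ring: a left inverse at the point, lifted to
  constant polynomials, gives a product that is the identity at the point. That product is
  invertible over the local ring, and its inverse corrects the lift.\<close>

lemma local_left_inverse:
  fixes M :: "'a::field poly mat"
  assumes M: "M \<in> carrier_mat p n" and rank: "vec_space.rank p (eval_mat M l) = n"
  shows "\<exists>X \<in> loc.omat l n p. X * map_mat to_fract M = 1\<^sub>m n"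
proof -
  obtain X0 where X0: "X0 \<in> carrier_mat n p" "X0 * eval_mat M l = 1\<^sub>m n"
    using full_column_rank_left_inverse[OF eval_mat_carrier[OF M] rank] by blast
  define X1 where "X1 = map_mat (\<lambda>c. [:c:]) X0"
  have X1: "X1 \<in> carrier_mat n p" "eval_mat X1 l = X0"
    using X0(1) by (auto simp: X1_def eval_mat_def)
  have "map_mat to_fract (X1 * M) \<in> loc.gl l n"
    using X0 X1 M by (intro gl_of_eval_eq_one) (auto simp: eval_mat_mult)
  then obtain U where U: "U \<in> loc.gl l n" "U * map_mat to_fract (X1 * M) = 1\<^sub>m n"
    by (rule loc.glE)
  have "U * map_mat to_fract X1 * map_mat to_fract M = U * (map_mat to_fract X1 * map_mat to_fract M)"
    by (rule assoc_mult_mat) (use loc.gl_carrier[OF U(1)] X1 M in auto)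
  then have "U * map_mat to_fract X1 * map_mat to_fract M = 1\<^sub>m n"
    using U(2) to_fract_hom.mat_hom_mult[OF X1(1) M] by simp
  then show ?thesis
    using loc.gl_omat[OF U(1)] X1(1) by (intro bexI[of _ "U * map_mat to_fract X1"] loc.omat_mult) auto
qed

lemma local_right_inverse:
  fixes M :: "'a::field poly mat"
  assumes M: "M \<in> carrier_mat n m" and rank: "vec_space.rank n (eval_mat M l) = n"
  shows "\<exists>X \<in> loc.omat l m n. map_mat to_fract M * X = 1\<^sub>m n"
proof -
  obtain X0 where X0: "X0 \<in> carrier_mat m n" "eval_mat M l * X0 = 1\<^sub>m n"
    using full_row_rank_right_inverse[OF eval_mat_carrier[OF M] rank] by blast
  define X1 where "X1 = map_mat (\<lambda>c. [:c:]) X0"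
  have X1: "X1 \<in> carrier_mat m n" "eval_mat X1 l = X0"
    using X0(1) by (auto simp: X1_def eval_mat_def)
  have "map_mat to_fract (M * X1) \<in> loc.gl l n"
    using X0 X1 M by (intro gl_of_eval_eq_one) (auto simp: eval_mat_mult)
  then obtain U where U: "U \<in> loc.gl l n" "map_mat to_fract (M * X1) * U = 1\<^sub>m n"
    by (rule loc.glE)
  have "map_mat to_fract M * map_mat to_fract X1 * U = map_mat to_fract M * (map_mat to_fract X1 * U)"
    by (rule assoc_mult_mat) (use loc.gl_carrier[OF U(1)] X1 M in auto)
  then have "map_mat to_fract M * (map_mat to_fract X1 * U) = 1\<^sub>m n"
    using U(2) to_fract_hom.mat_hom_mult[OF M X1(1)] by simp
  then show ?thesis
    using loc.gl_omat[OF U(1)] X1(1) by (intro bexI[of _ "map_mat to_fract X1 * U"] loc.omat_mult) auto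
qed

section \<open>Block equivalences and the main theorem\<close>

context valuation_subring
begin

lemma gl_four_block_lower:
  assumes "A \<in> gl n" "D \<in> gl k" "C \<in> omat k n"
  shows "four_block_mat A (0\<^sub>m n k) C D \<in> gl (n + k)"
proof (rule gl_of_det)
  note c = assms(1,2)[THEN gl_carrier] omat_carrier[OF assms(3)]
  have det: "det (four_block_mat A (0\<^sub>m n k) C D) = det A * det D"
    by (rule det_four_block_mat_upper_right_zero) (use c in auto)
  show "four_block_mat A (0\<^sub>m n k) C D \<in> omat (n + k) (n + k)"
    using assms by (intro omat_four_block) (auto intro: gl_omat)
  show "det (four_block_mat A (0\<^sub>m n k) C D) \<noteq> 0" "inverse (det (four_block_mat A (0\<^sub>m n k) C D)) \<in> V"
    unfolding det using gl_det[OF assms(1)] gl_det[OF assms(2)] by auto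
qed

lemma gl_four_block_upper:
  assumes "A \<in> gl n" "D \<in> gl k" "B \<in> omat n k"
  shows "four_block_mat A B (0\<^sub>m k n) D \<in> gl (n + k)"
proof (rule gl_of_det)
  note c = assms(1,2)[THEN gl_carrier] omat_carrier[OF assms(3)]
  have det: "det (four_block_mat A B (0\<^sub>m k n) D) = det A * det D"
    by (rule det_four_block_mat_lower_left_zero) (use c in auto)
  show "four_block_mat A B (0\<^sub>m k n) D \<in> omat (n + k) (n + k)"
    using assms by (intro omat_four_block) (auto intro: gl_omat)
  show "det (four_block_mat A B (0\<^sub>m k n) D) \<noteq> 0" "inverse (det (four_block_mat A B (0\<^sub>m k n) D)) \<in> V"
    unfolding det using gl_det[OF assms(1)] gl_det[OF assms(2)] by auto
qed

lemma gl_uminus: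
  assumes "A \<in> gl n"
  shows "- A \<in> gl n"
proof -
  obtain A' where "A' \<in> gl n" "A * A' = 1\<^sub>m n" "A' * A = 1\<^sub>m n" using assms by (rule glE)
  then show ?thesis
    using assms[THEN gl_carrier] gl_carrier[of A' n]
    by (intro glI[of _ _ "- A'"]) (auto intro: gl_omat assms)
qed

lemma oequiv_diag_block:
  assumes "oequiv p m G G'" "oequiv k n H H'"
  shows "oequiv (p + k) (m + n) (four_block_mat G (0\<^sub>m p n) (0\<^sub>m k m) H) (four_block_mat G' (0\<^sub>m p n) (0\<^sub>m k m) H')"
proof -
  obtain L R where 1: "L \<in> gl p" "R \<in> gl m" "G = L * G' * R" "G' \<in> carrier_mat p m"
    using assms(1) by (auto simp: oequiv_def)
  obtain K T where 2: "K \<in> gl k" "T \<in> gl n" "H = K * H' * T" "H' \<in> carrier_mat k n"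
    using assms(2) by (auto simp: oequiv_def)
  note c = 1(1,2)[THEN gl_carrier] 2(1,2)[THEN gl_carrier] 1(4) 2(4)
  have c': "L * G' \<in> carrier_mat p m" "K * H' \<in> carrier_mat k n" using c by auto
  have "four_block_mat L (0\<^sub>m p k) (0\<^sub>m k p) K * four_block_mat G' (0\<^sub>m p n) (0\<^sub>m k m) H'
      = four_block_mat (L * G') (0\<^sub>m p n) (0\<^sub>m k m) (K * H')"
    by (subst mult_four_block_mat[of _ p p _ k _ k _ _ m _ n]) (use c in auto)
  moreover have "four_block_mat (L * G') (0\<^sub>m p n) (0\<^sub>m k m) (K * H') * four_block_mat R (0\<^sub>m m n) (0\<^sub>m n m) T
      = four_block_mat G (0\<^sub>m p n) (0\<^sub>m k m) H"
    unfolding 1(3) 2(3)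
    by (subst mult_four_block_mat[of _ p m _ n _ k _ _ m _ n]) (use c c' in auto)
  ultimately show ?thesis
    using 1 2 c
    by (intro oequivI[of _ _ _ "four_block_mat L (0\<^sub>m p k) (0\<^sub>m k p) K" "four_block_mat R (0\<^sub>m m n) (0\<^sub>m n m) T"]
        gl_four_block_lower) auto
qed

text \<open>Adding \<open>K\<close> times the second block row and subtracting multiples by
  \<open>R\<close> of the second block column turns \<open>P\<close> into
  \<open>P - K * Q * R\<close>. The one-sided inverses \<open>x\<close> and \<open>y\<close> then
  eliminate \<open>Q\<close> from all other blocks. \<open>Q\<close> may be nonintegral, since it
  occurs in none of the transformations.\<close>

lemma oequiv_coprime_block:
  assumes P: "P \<in> carrier_mat N M" and Q: "Q \<in> carrier_mat n n" and K: "K \<in> omat N n" and R: "R \<in> omat n M"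
    and x: "x \<in> omat M n" "R * x = 1\<^sub>m n" and y: "y \<in> omat n N" "y * K = 1\<^sub>m n"
  shows "oequiv (N + n) (M + n) (four_block_mat P (0\<^sub>m N n) (0\<^sub>m n M) Q)
    (four_block_mat (P - K * Q * R) (P * x) (y * P) (y * P * x))"
proof -
  note c = P Q K[THEN omat_carrier] R[THEN omat_carrier] x(1)[THEN omat_carrier] y(1)[THEN omat_carrier]
  let ?T = "four_block_mat P (0\<^sub>m N n) (0\<^sub>m n M) Q" and ?H = "P - K * Q * R"
  let ?U1 = "four_block_mat (1\<^sub>m N) K (0\<^sub>m n N) (1\<^sub>m n)" and ?U2 = "four_block_mat (1\<^sub>m N) (0\<^sub>m N n) y (- 1\<^sub>m n)"
  let ?W1 = "four_block_mat (1\<^sub>m M) (0\<^sub>m M n) (- R) (1\<^sub>m n)" and ?W2 = "four_block_mat (1\<^sub>m M) x (0\<^sub>m n M) (1\<^sub>m n)"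
  note cc = mult_carrier_mat[OF c(3,2)] mult_carrier_mat[OF c(2,4)] mult_carrier_mat[OF mult_carrier_mat[OF c(3,2)] c(4)]
    minus_carrier_mat[OF mult_carrier_mat[OF mult_carrier_mat[OF c(3,2)] c(4)], of P]
    mult_carrier_mat[OF c(1,5)] mult_carrier_mat[OF c(6,1)]
  have "K * Q * R * x = K * Q * (R * x)"
    by (rule assoc_mult_mat[OF cc(1) c(4,5)])
  then have KQRx: "K * Q * R * x = K * Q"
    using cc(1) by (simp only: x(2) right_mult_one_mat)
  have QRx: "Q * R * x = Q"
    using assoc_mult_mat[of Q n n R M x n] c x(2) by simp
  have "y * (K * (Q * R)) = y * K * (Q * R)"
    by (rule assoc_mult_mat[OF c(6,3) cc(2), symmetric])
  then have yKQR: "y * (K * Q * R) = Q * R"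
    using assoc_mult_mat[of K N n Q n R M] c cc y(2) by simp
  have e1: "?U1 * ?T = four_block_mat P (K * Q) (0\<^sub>m n M) Q"
    by (subst mult_four_block_mat[of _ N N _ n _ n _ _ M _ n]) (use c cc in auto)
  have e2: "four_block_mat P (K * Q) (0\<^sub>m n M) Q * ?W1 = four_block_mat ?H (K * Q) (- (Q * R)) Q"
    by (subst mult_four_block_mat[of _ N M _ n _ n _ _ M _ n])
      (use c cc in \<open>auto simp: add_uminus_minus_mat uminus_mult_right_mat\<close>)
  \<comment> \<open>As \<open>R * x\<close> is the identity, the contribution of \<open>Q\<close> to
    the border cancels; \<open>y\<close> has the same effect on the lower border.\<close>
  have Hx: "?H * x + K * Q = P * x"
    by (subst minus_mult_distrib_mat[of _ N M]) (use c cc KQRx in \<open>auto intro!: eq_matI\<close>)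
  have e3: "four_block_mat ?H (K * Q) (- (Q * R)) Q * ?W2 = four_block_mat ?H (P * x) (- (Q * R)) (0\<^sub>m n n)"
    by (subst mult_four_block_mat[of _ N M _ n _ n _ _ M _ n])
      (use c cc Hx QRx in \<open>auto simp: uminus_mult_left_mat\<close>)
  have yH: "y * ?H + Q * R = y * P"
    by (subst mult_minus_distrib_mat[of _ n N]) (use c cc yKQR in \<open>auto intro!: eq_matI\<close>)
  have neg: "- 1\<^sub>m n * - (Q * R) = Q * R" "- 1\<^sub>m n * 0\<^sub>m n n = (0\<^sub>m n n :: 'k mat)"
    using uminus_mult_left_mat[of "1\<^sub>m n" "- (Q * R)"] cc(2) by (auto intro!: eq_matI)
  have QR: "- (Q * R) \<in> carrier_mat n M" using cc(2) by simp
  note unit = left_mult_one_mat[OF cc(4)] left_mult_one_mat[OF cc(5)] left_mult_zero_mat[OF QR] left_mult_zero_mat[OF zero_carrier_mat]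
    right_add_zero_mat[OF cc(4)] right_add_zero_mat[OF cc(5)] right_add_zero_mat[OF mult_carrier_mat[OF c(6) cc(5)]]
  have e4: "?U2 * four_block_mat ?H (P * x) (- (Q * R)) (0\<^sub>m n n)
      = four_block_mat ?H (P * x) (y * P) (y * (P * x))"
    by (subst mult_four_block_mat[OF one_carrier_mat zero_carrier_mat c(6) _ cc(4,5)])
      (simp_all only: unit neg yH QR cc(2) zero_carrier_mat uminus_carrier_iff_mat one_carrier_mat)
  have yPx: "y * (P * x) = y * P * x"
    by (rule assoc_mult_mat[symmetric]) (use c in auto)
  have gl: "?U1 \<in> gl (N + n)" "?U2 \<in> gl (N + n)" "?W1 \<in> gl (M + n)" "?W2 \<in> gl (M + n)"
    using K R x y by (auto intro!: gl_four_block_lower gl_four_block_upper gl_uminus)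
  have T: "?T \<in> carrier_mat (N + n) (M + n)" using c by auto
  have "oequiv (N + n) (M + n) (?U2 * (?U1 * ?T * ?W1 * ?W2)) (?U1 * ?T * ?W1 * ?W2)"
    using gl T gl[THEN gl_carrier] by (intro oequiv_left) (auto simp del: four_block_carrier_mat)
  also have "oequiv (N + n) (M + n) (?U1 * ?T * ?W1 * ?W2) (?U1 * ?T * ?W1)"
    using gl T gl[THEN gl_carrier] by (intro oequiv_right) (auto simp del: four_block_carrier_mat)
  also have "oequiv (N + n) (M + n) (?U1 * ?T * ?W1) (?U1 * ?T)"
    using gl T gl[THEN gl_carrier] by (intro oequiv_right) (auto simp del: four_block_carrier_mat)
  also have "oequiv (N + n) (M + n) (?U1 * ?T) ?T"
    using gl T gl[THEN gl_carrier] by (intro oequiv_left) (auto simp del: four_block_carrier_mat)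
  finally show ?thesis
    unfolding e1 e2 e3 e4 yPx by (rule oequiv_sym)
qed

text \<open>After the change by \<open>L\<close> and \<open>R\<close>, the rows of \<open>f\<close>
  annihilate the main block and form a left inverse of the border column. Subtracting
  \<open>u * f\<close> times the first block row therefore removes \<open>u\<close> and leaves the
  lower border alone.\<close>

lemma oequiv_clear_corner:
  assumes L: "L \<in> gl N" and R: "R \<in> gl M" and H: "H \<in> carrier_mat N M" and w: "w \<in> carrier_mat N n"
    and z: "z \<in> carrier_mat n M" and u: "u \<in> omat n n" and f: "f \<in> omat n N"
    and fH: "f * (L * H * R) = 0\<^sub>m n M" and fw: "f * (L * w) = 1\<^sub>m n"
  shows "oequiv (N + n) (M + n) (four_block_mat H w z u) (four_block_mat (L * H * R) (L * w) (z * R) (0\<^sub>m n n))"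
proof -
  note c = L[THEN gl_carrier] R[THEN gl_carrier] H w z u[THEN omat_carrier] f[THEN omat_carrier]
  define H' w' z' where defs: "H' = L * H * R" "w' = L * w" "z' = z * R"
  let ?T = "four_block_mat H w z u"
  let ?M1 = "four_block_mat L (0\<^sub>m N n) (0\<^sub>m n N) (1\<^sub>m n)" and ?M2 = "four_block_mat R (0\<^sub>m M n) (0\<^sub>m n M) (1\<^sub>m n)"
  let ?M3 = "four_block_mat (1\<^sub>m N) (0\<^sub>m N n) (- (u * f)) (1\<^sub>m n)"
  have bc: "L * H \<in> carrier_mat N M" "H' \<in> carrier_mat N M" "w' \<in> carrier_mat N n" "z' \<in> carrier_mat n M" "u * f \<in> carrier_mat n N"
    unfolding defs using c by (auto intro!: mult_carrier_mat)
  have e1: "?M1 * ?T = four_block_mat (L * H) w' z u"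
    unfolding defs by (subst mult_four_block_mat[of _ N N _ n _ n _ _ M _ n]) (use c in auto)
  have e2: "four_block_mat (L * H) w' z u * ?M2 = four_block_mat H' w' z' u"
    by (subst mult_four_block_mat[of _ N M _ n _ n _ _ M _ n])
      (use c bc(1,3) in \<open>auto simp: defs(1,3) simp del: assoc_mult_mat\<close>)
  have "- (u * f) * H' = - (u * f * H')" "- (u * f) * w' = - (u * f * w')"
    using bc by (simp_all only: uminus_mult_left_mat carrier_matD)
  moreover have "u * f * H' = 0\<^sub>m n M"
    unfolding assoc_mult_mat[OF c(6,7) bc(2)] fH[folded defs(1)] using c(6) by simp
  moreover have "u * f * w' = u"
    unfolding assoc_mult_mat[OF c(6,7) bc(3)] fw[folded defs(2)] using c(6) by simp
  moreover have "- 0\<^sub>m n M = (0\<^sub>m n M :: 'k mat)"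
    by (rule eq_matI) auto
  ultimately have uf: "- (u * f) * H' = 0\<^sub>m n M" "- (u * f) * w' = - u"
    by (simp_all only:)
  have e3: "?M3 * four_block_mat H' w' z' u = four_block_mat H' w' z' (0\<^sub>m n n)"
    by (subst mult_four_block_mat[of _ N N _ n _ n _ _ M _ n])
      (use c bc uf in \<open>auto simp del: assoc_mult_mat simp: uminus_l_inv_mat\<close>)
  have gl: "?M1 \<in> gl (N + n)" "?M2 \<in> gl (M + n)" "?M3 \<in> gl (N + n)"
    using L R omat_uminus[OF omat_mult[OF u f]] by (auto intro!: gl_four_block_lower)
  have T: "?T \<in> carrier_mat (N + n) (M + n)" using c by auto
  have "oequiv (N + n) (M + n) (?M3 * (?M1 * ?T * ?M2)) (?M1 * ?T * ?M2)"
    using gl T gl[THEN gl_carrier] by (intro oequiv_left mult_carrier_mat)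
  also have "oequiv (N + n) (M + n) (?M1 * ?T * ?M2) (?M1 * ?T)"
    using gl T gl[THEN gl_carrier] by (intro oequiv_right mult_carrier_mat)
  also have "oequiv (N + n) (M + n) (?M1 * ?T) ?T"
    using gl T gl[THEN gl_carrier] by (intro oequiv_left mult_carrier_mat)
  finally show ?thesis
    unfolding e1 e2 e3 unfolding defs by (rule oequiv_sym)
qed

text \<open>The identity blocks of the borders clear \<open>g\<close> and \<open>h\<close>. Rows and
  columns of the zero blocks are the only ones used for this, so \<open>G\<close> itself is changed
  just by its own transformations.\<close>

lemma oequiv_unit_border:
  assumes eq: "oequiv p m G S" and g: "g \<in> omat p n" and h: "h \<in> omat n m" and u: "u \<in> omat n n"
  shows "oequiv (n + p + n) (n + m + n)
    (four_block_mat (four_block_mat (0\<^sub>m n n) (0\<^sub>m n m) (0\<^sub>m p n) G)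
      (four_block_mat (1\<^sub>m n) (0\<^sub>m n 0) g (0\<^sub>m p 0)) (four_block_mat (1\<^sub>m n) h (0\<^sub>m 0 n) (0\<^sub>m 0 m)) u)
    (four_block_mat (four_block_mat (0\<^sub>m n n) (0\<^sub>m n m) (0\<^sub>m p n) S)
      (four_block_mat (1\<^sub>m n) (0\<^sub>m n 0) (0\<^sub>m p n) (0\<^sub>m p 0))
      (four_block_mat (1\<^sub>m n) (0\<^sub>m n m) (0\<^sub>m 0 n) (0\<^sub>m 0 m)) (0\<^sub>m n n))"
    (is "oequiv _ _ (four_block_mat ?H ?w ?z u) (four_block_mat ?H' ?E ?F _)")
proof -
  obtain L R where LR: "L \<in> gl p" "R \<in> gl m" "S = L * G * R"
    using oequiv_sym[OF eq] by (auto simp: oequiv_def)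
  note c = LR(1,2)[THEN gl_carrier] g[THEN omat_carrier] h[THEN omat_carrier] u[THEN omat_carrier]
    oequiv_carrier[OF eq, THEN conjunct1] oequiv_carrier[OF eq, THEN conjunct2]
  let ?T = "four_block_mat ?H ?w ?z u"
  \<comment> \<open>Selects the first \<open>n\<close> rows: zero in the main block, the identity in
    the border. The empty blocks give it the shape required for block multiplication.\<close>
  let ?F' = "four_block_mat (1\<^sub>m n) (0\<^sub>m n p) (0\<^sub>m 0 n) (0\<^sub>m 0 p) :: 'k mat"
  let ?L1 = "four_block_mat (1\<^sub>m n) (0\<^sub>m n p) (- (L * g)) L" and ?R1 = "four_block_mat (1\<^sub>m n) (- (h * R)) (0\<^sub>m m n) R"
  have Lg: "L * g \<in> carrier_mat p n" "h * R \<in> carrier_mat n m" "L * G \<in> carrier_mat p m" using c by auto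
  have "?L1 * ?H = four_block_mat (0\<^sub>m n n) (0\<^sub>m n m) (0\<^sub>m p n) (L * G)"
    by (subst mult_four_block_mat[of _ n n _ p _ p _ _ n _ m]) (use c Lg in auto)
  moreover have "four_block_mat (0\<^sub>m n n) (0\<^sub>m n m) (0\<^sub>m p n) (L * G) * ?R1 = ?H'"
    unfolding LR(3) by (subst mult_four_block_mat[of _ n n _ m _ p _ _ n _ m]) (use c Lg in auto)
  ultimately have H: "?L1 * ?H * ?R1 = ?H'" by simp
  have w: "?L1 * ?w = ?E"
    by (subst mult_four_block_mat[of _ n n _ p _ p _ _ n _ 0]) (use c Lg in \<open>auto intro!: cong_four_block_mat\<close>)
  have z: "?z * ?R1 = ?F"
    by (subst mult_four_block_mat[of _ n n _ m _ 0 _ _ n _ m])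
      (use c Lg in \<open>auto intro!: cong_four_block_mat simp: uminus_l_inv_mat\<close>)
  have F'H: "?F' * ?H' = 0\<^sub>m n (n + m)"
    by (subst mult_four_block_mat[of _ n n _ p _ 0 _ _ n _ m]) (use c in \<open>auto intro!: eq_matI\<close>)
  have F'E: "?F' * ?E = 1\<^sub>m n"
    by (subst mult_four_block_mat[of _ n n _ p _ 0 _ _ n _ 0]) (use c in \<open>auto intro!: eq_matI\<close>)
  have gl: "?L1 \<in> gl (n + p)"
    by (rule gl_four_block_lower[OF gl_one LR(1) omat_uminus[OF omat_mult[OF gl_omat[OF LR(1)] g]]])
  have gl': "?R1 \<in> gl (n + m)"
    by (rule gl_four_block_upper[OF gl_one LR(2) omat_uminus[OF omat_mult[OF h gl_omat[OF LR(2)]]]])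
  have bc: "?H \<in> carrier_mat (n + p) (n + m)" "?w \<in> carrier_mat (n + p) (n + 0)" "?z \<in> carrier_mat (n + 0) (n + m)"
    using c four_block_carrier_mat[of "0\<^sub>m n n" n n G p m] four_block_carrier_mat[of "1\<^sub>m n" n n "0\<^sub>m p 0" p 0]
      four_block_carrier_mat[of "1\<^sub>m n" n n "0\<^sub>m 0 m" 0 m] by simp_all
  have f: "?F' \<in> omat (n + 0) (n + p)"
    by (intro omat_four_block) simp_all
  show ?thesis
    using oequiv_clear_corner[OF gl gl' bc[unfolded add_0_right] u f[unfolded add_0_right]] F'H F'E
    unfolding H w z by simp
qed

text \<open>The preceding block lemmas with K = [A; -C], R = [A B] and Q the inverse of A. Then K Q
  R agrees with P except in the last block, so the difference has the transfer function there and
  zeros elsewhere.\<close>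

lemma oequiv_system_transfer:
  assumes A: "A \<in> omat n n" and B: "B \<in> omat n m" and C: "C \<in> omat p n" and D: "D \<in> omat p m"
    and Q: "Q \<in> carrier_mat n n" "A * Q = 1\<^sub>m n" "Q * A = 1\<^sub>m n"
    and X: "X \<in> omat n n" "Y \<in> omat m n" "A * X + B * Y = 1\<^sub>m n"
    and X': "X' \<in> omat n n" "Y' \<in> omat n p" "X' * A + Y' * C = 1\<^sub>m n"
    and eq: "oequiv p m (D + C * Q * B) S"
  shows "oequiv (n + p + n) (n + m + n)
    (four_block_mat (four_block_mat A B (- C) D) (0\<^sub>m (n + p) n) (0\<^sub>m n (n + m)) Q)
    (four_block_mat (four_block_mat (0\<^sub>m n n) (0\<^sub>m n m) (0\<^sub>m p n) S)
      (four_block_mat (1\<^sub>m n) (0\<^sub>m n 0) (0\<^sub>m p n) (0\<^sub>m p 0))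
      (four_block_mat (1\<^sub>m n) (0\<^sub>m n m) (0\<^sub>m 0 n) (0\<^sub>m 0 m)) (0\<^sub>m n n))"
proof -
  note c = assms(1-4)[THEN omat_carrier] Q(1) X(1,2)[THEN omat_carrier] X'(1,2)[THEN omat_carrier]
  let ?P = "four_block_mat A B (- C) D"
  let ?K = "four_block_mat A (0\<^sub>m n 0) (- C) (0\<^sub>m p 0)" and ?R = "four_block_mat A B (0\<^sub>m 0 n) (0\<^sub>m 0 m)"
  \<comment> \<open>The Bezout identities, read as one-sided inverses. The sign of \<open>Y'\<close>
    compensates that of \<open>- C\<close>.\<close>
  let ?x = "four_block_mat X (0\<^sub>m n 0) Y (0\<^sub>m m 0)" and ?y = "four_block_mat X' (- Y') (0\<^sub>m 0 n) (0\<^sub>m 0 p)"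
  have one: "four_block_mat (1\<^sub>m n) (0\<^sub>m n 0) (0\<^sub>m 0 n) (0\<^sub>m 0 0) = (1\<^sub>m n :: 'k mat)"
    by (rule eq_matI) auto
  have Q4: "Q = four_block_mat Q (0\<^sub>m n 0) (0\<^sub>m 0 n) (0\<^sub>m 0 0)"
    using Q(1) by (intro eq_matI) auto
  have om: "?P \<in> omat (n + p) (n + m)" "?K \<in> omat (n + p) n" "?R \<in> omat n (n + m)" "?x \<in> omat (n + m) n" "?y \<in> omat n (n + p)"
    using omat_four_block[of A n n B m "- C" p D] omat_four_block[of A n n "0\<^sub>m n 0" 0 "- C" p "0\<^sub>m p 0"]
      omat_four_block[of A n n B m "0\<^sub>m 0 n" 0 "0\<^sub>m 0 m"] omat_four_block[of X n n "0\<^sub>m n 0" 0 Y m "0\<^sub>m m 0"]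
      omat_four_block[of X' n n "- Y'" p "0\<^sub>m 0 n" 0 "0\<^sub>m 0 p"] A B C D X X' by (simp_all add: omat_uminus)
  have Rx: "?R * ?x = 1\<^sub>m n"
    by (subst mult_four_block_mat[of _ n n _ m _ 0 _ _ n _ 0]) (use c X(3) one in \<open>auto simp: one\<close>)
  have YC: "Y' * C \<in> carrier_mat n n" "Y' * D \<in> carrier_mat n m" "C * X \<in> carrier_mat p n" "C * Q \<in> carrier_mat p n"
    "C * Q * B \<in> carrier_mat p m" using c by (auto intro!: mult_carrier_mat)
  have YC': "- Y' * - C = Y' * C"
    using c by (simp add: uminus_mult_left_mat uminus_mult_right_mat)
  have yK: "?y * ?K = 1\<^sub>m n"
    by (subst mult_four_block_mat[of _ n n _ p _ 0 _ _ n _ 0]) (use c X'(3) YC' in \<open>auto simp: one\<close>)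
  have KQ: "?K * Q = four_block_mat (1\<^sub>m n) (0\<^sub>m n 0) (- (C * Q)) (0\<^sub>m p 0)"
    by (subst Q4, subst mult_four_block_mat[of _ n n _ 0 _ p _ _ n _ 0])
      (use c Q YC uminus_mult_left_mat[of C Q] in auto)
  have CQA: "C * Q * A = C"
    using assoc_mult_mat[OF c(3) c(5) c(1)] Q(3) c(3) by simp
  have KQR: "?K * Q * ?R = four_block_mat A B (- C) (- (C * Q * B))"
    unfolding KQ
    by (subst mult_four_block_mat[of _ n n _ 0 _ p _ _ n _ m])
      (use c YC CQA uminus_mult_left_mat[of "C * Q" A] uminus_mult_left_mat[of "C * Q" B] in \<open>auto simp del: assoc_mult_mat\<close>)
  have H: "?P - ?K * Q * ?R = four_block_mat (0\<^sub>m n n) (0\<^sub>m n m) (0\<^sub>m p n) (D + C * Q * B)"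
    unfolding KQR by (rule eq_matI) (use c YC in \<open>auto simp del: assoc_mult_mat index_mult_mat(1)\<close>)
  \<comment> \<open>The first block row of \<open>P\<close> is [A B], so the border starts with the
    identity; likewise the first block column of \<open>P\<close> for the border below.\<close>
  have Px: "?P * ?x = four_block_mat (1\<^sub>m n) (0\<^sub>m n 0) (- C * X + D * Y) (0\<^sub>m p 0)"
    by (subst mult_four_block_mat[of _ n n _ m _ p _ _ n _ 0]) (use c X(3) in auto)
  have yP: "?y * ?P = four_block_mat (1\<^sub>m n) (X' * B + - Y' * D) (0\<^sub>m 0 n) (0\<^sub>m 0 m)"
    by (subst mult_four_block_mat[of _ n n _ p _ 0 _ _ n _ m]) (use c X'(3) YC' in auto)
  have "oequiv (n + p + n) (n + m + n) (four_block_mat ?P (0\<^sub>m (n + p) n) (0\<^sub>m n (n + m)) Q)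
    (four_block_mat (?P - ?K * Q * ?R) (?P * ?x) (?y * ?P) (?y * ?P * ?x))"
    by (rule oequiv_coprime_block[OF omat_carrier[OF om(1)] Q(1) om(2,3,4) Rx om(5) yK])
  also have "oequiv (n + p + n) (n + m + n) \<dots> (four_block_mat (four_block_mat (0\<^sub>m n n) (0\<^sub>m n m) (0\<^sub>m p n) S)
      (four_block_mat (1\<^sub>m n) (0\<^sub>m n 0) (0\<^sub>m p n) (0\<^sub>m p 0))
      (four_block_mat (1\<^sub>m n) (0\<^sub>m n m) (0\<^sub>m 0 n) (0\<^sub>m 0 m)) (0\<^sub>m n n))"
    unfolding H Px
  proof (subst yP, rule oequiv_unit_border[OF eq])
    show "- C * X + D * Y \<in> omat p n" "X' * B + - Y' * D \<in> omat n m"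
      using A B C D X X' by (auto intro!: omat_add omat_mult omat_uminus)
    show "?y * ?P * ?x \<in> omat n n"
      using om by (intro omat_mult)
  qed
  finally show ?thesis .
qed

end

lemma four_block_mat_empty:
  "M \<in> carrier_mat n m \<Longrightarrow> X \<in> carrier_mat n 0 \<Longrightarrow> Y \<in> carrier_mat 0 m \<Longrightarrow> Z \<in> carrier_mat 0 0 \<Longrightarrow>
   four_block_mat M X Y Z = M"
  by (rule eq_matI) auto

section \<open>Monomial forms of the block matrices\<close>

lemma monomial_mat_diag_block:
  assumes D: "monomial_data N M I \<sigma> d" and E: "monomial_data n m J \<tau> e"
  defines "K \<equiv> I \<union> (+) N ` J" and "\<rho> \<equiv> \<lambda>i. if i < N then \<sigma> i else M + \<tau> (i - N)"
    and "f \<equiv> \<lambda>i. if i < N then d i else e (i - N)"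
  shows "monomial_data (N + n) (M + m) K \<rho> f"
    and "four_block_mat (monomial_mat N M I \<sigma> d) (0\<^sub>m N m) (0\<^sub>m n M) (monomial_mat n m J \<tau> e) = monomial_mat (N + n) (M + m) K \<rho> f"
proof -
  have I: "i < N" "\<sigma> i < M" "d i \<noteq> 0" if "i \<in> I" for i using D that by (auto simp: monomial_data_def)
  have J: "j < n" "\<tau> j < m" "e j \<noteq> 0" if "j \<in> J" for j using E that by (auto simp: monomial_data_def)
  have inj: "inj_on \<sigma> I" "inj_on \<tau> J" using D E by (auto simp: monomial_data_def)
  have "inj_on \<rho> K"
  proof (rule inj_onI)
    fix i j assume "i \<in> K" "j \<in> K" "\<rho> i = \<rho> j"
    then show "i = j"
      using inj_onD[OF inj(1), of i j] inj_onD[OF inj(2), of "i - N" "j - N"] I(1,2)[of i] I(1,2)[of j]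
      by (auto simp: K_def \<rho>_def)
  qed
  moreover have "i < N + n \<and> \<rho> i < M + m \<and> f i \<noteq> 0" if "i \<in> K" for i
    using that I[of i] J[of "i - N"] by (auto simp: K_def \<rho>_def f_def)
  ultimately show "monomial_data (N + n) (M + m) K \<rho> f"
    unfolding monomial_data_def by blast
  show "four_block_mat (monomial_mat N M I \<sigma> d) (0\<^sub>m N m) (0\<^sub>m n M) (monomial_mat n m J \<tau> e) = monomial_mat (N + n) (M + m) K \<rho> f"
  proof (rule eq_matI)
    fix i j
    assume "i < dim_row (monomial_mat (N + n) (M + m) K \<rho> f)" "j < dim_col (monomial_mat (N + n) (M + m) K \<rho> f)"
    then have ij: "i < N + n" "j < M + m" by auto
    have K: "i \<in> K \<longleftrightarrow> (if i < N then i \<in> I else i - N \<in> J)"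
      using I(1)[of i] by (auto simp: K_def image_iff intro: bexI[of _ "i - N"])
    show "four_block_mat (monomial_mat N M I \<sigma> d) (0\<^sub>m N m) (0\<^sub>m n M) (monomial_mat n m J \<tau> e) $$ (i, j)
        = monomial_mat (N + n) (M + m) K \<rho> f $$ (i, j)"
      using ij I(2)[of i] K by (auto simp: \<rho>_def f_def)
  qed auto
qed

text \<open>The first \<open>n\<close> rows have their pivots in the last \<open>n\<close> columns
  and vice versa. These \<open>2 * n\<close> pivots are 1 and will contribute the zero
  orders.\<close>

lemma monomial_mat_border:
  fixes d :: "nat \<Rightarrow> 'k::field" and n :: nat
  assumes D: "monomial_data p m I \<sigma> d"
  defines "K \<equiv> {..<n} \<union> (+) n ` I \<union> {n + p..<n + p + n}"
    and "\<rho> \<equiv> \<lambda>i. if i < n then n + m + i else if i < n + p then n + \<sigma> (i - n) else i - (n + p)"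
    and "f \<equiv> \<lambda>i. if n \<le> i \<and> i < n + p then d (i - n) else 1"
  shows "monomial_data (n + p + n) (n + m + n) K \<rho> f"
    and "four_block_mat (four_block_mat (0\<^sub>m n n) (0\<^sub>m n m) (0\<^sub>m p n) (monomial_mat p m I \<sigma> d))
      (four_block_mat (1\<^sub>m n) (0\<^sub>m n 0) (0\<^sub>m p n) (0\<^sub>m p 0))
      (four_block_mat (1\<^sub>m n) (0\<^sub>m n m) (0\<^sub>m 0 n) (0\<^sub>m 0 m)) (0\<^sub>m n n)
      = monomial_mat (n + p + n) (n + m + n) K \<rho> f" (is "?B = _")
proof -
  have I: "i < p" "\<sigma> i < m" "d i \<noteq> 0" if "i \<in> I" for i using D that by (auto simp: monomial_data_def)
  have inj: "inj_on \<sigma> I" using D by (auto simp: monomial_data_def)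
  have "inj_on \<rho> K"
  proof (rule inj_onI)
    fix i j assume "i \<in> K" "j \<in> K" "\<rho> i = \<rho> j"
    then show "i = j"
      using inj_onD[OF inj, of "i - n" "j - n"] I(1,2)[of "i - n"] I(1,2)[of "j - n"]
      by (auto simp: K_def \<rho>_def split: if_splits)
  qed
  moreover have "i < n + p + n \<and> \<rho> i < n + m + n \<and> f i \<noteq> 0" if "i \<in> K" for i
    using that I[of "i - n"] by (auto simp: K_def \<rho>_def f_def)
  ultimately show "monomial_data (n + p + n) (n + m + n) K \<rho> f"
    unfolding monomial_data_def by blast
  show "?B = monomial_mat (n + p + n) (n + m + n) K \<rho> f"
  proof (rule eq_matI)
    fix i j
    assume "i < dim_row (monomial_mat (n + p + n) (n + m + n) K \<rho> f)" "j < dim_col (monomial_mat (n + p + n) (n + m + n) K \<rho> f)"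
    then have ij: "i < n + p + n" "j < n + m + n" by auto
    consider "i < n" | "n \<le> i" "i < n + p" | "n + p \<le> i" by linarith
    then show "?B $$ (i, j) = monomial_mat (n + p + n) (n + m + n) K \<rho> f $$ (i, j)"
    proof cases
      case 1
      then show ?thesis using ij by (auto simp: K_def \<rho>_def f_def)
    next
      case 2
      then have "i \<in> K \<longleftrightarrow> i - n \<in> I"
        by (auto simp: K_def image_iff intro: bexI[of _ "i - n"])
      then show ?thesis using ij 2 I(2)[of "i - n"] by (auto simp: \<rho>_def f_def)
    next
      case 3
      then show ?thesis using ij by (auto simp: K_def \<rho>_def f_def)
    qed
  qed auto
qed

lemma image_mset_shifted:
  "image_mset f (mset_set ((+) n ` J)) = image_mset (\<lambda>j. f (n + j)) (mset_set J)" for n :: nat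
  by (simp add: image_mset_mset_set[symmetric] multiset.map_comp comp_def)

text \<open>Inverting A = L S R inverts the diagonal form between transformations. The exponents now
  decrease along the diagonal, so the result is a monomial matrix and not
  \<open>local_smith_mat\<close>.\<close>

lemma oequiv_inverse_smith:
  fixes A :: "'a::field poly fract mat" and l :: 'a
  assumes A: "A \<in> carrier_mat n n" and det: "det A \<noteq> 0" and Q: "Q \<in> carrier_mat n n" "A * Q = 1\<^sub>m n" "Q * A = 1\<^sub>m n"
  defines "as \<equiv> invariant_orders A l"
  shows "length as = n" "loc.oequiv l n n Q (monomial_mat n n {..<n} id (\<lambda>i. uniformizer l powi (- (as ! i))))"
proof -
  show len: "length as = n"
    using is_invariant_orders_invariant_orders[OF A, of l] vec_space.low_rank_det_zero[OF A det]
    unfolding is_invariant_orders_iff[OF A] as_def by simp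
  let ?S = "monomial_mat n n {..<n} id (\<lambda>i. uniformizer l powi (as ! i))"
    and ?Z = "monomial_mat n n {..<n} id (\<lambda>i. uniformizer l powi (- (as ! i)))"
  have S: "loc.oequiv l n n A ?S"
    using oequiv_smith(1)[OF A, of l] by (simp add: local_smith_mat_eq_monomial_mat as_def[symmetric] len)
  have "monomial_data n n {..<n} id (\<lambda>i. uniformizer l powi (as ! i))"
    by (auto simp: monomial_data_def)
  then have SZ: "?S * ?Z = 1\<^sub>m n"
    by (intro eq_matI)
      (auto simp: monomial_mat_mult_index[of _ n n] power_int_minus simp del: index_mult_mat(1))
  obtain L L' R R' where LR: "L \<in> loc.gl l n" "L' \<in> loc.gl l n" "R \<in> loc.gl l n" "R' \<in> loc.gl l n"
    "L * L' = 1\<^sub>m n" "R * R' = 1\<^sub>m n" "A = L * ?S * R"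
    using S by (rule loc.oequivE)
  note c = LR(1-4)[THEN loc.gl_carrier]
  have Zc: "?Z \<in> carrier_mat n n" "?S \<in> carrier_mat n n" by simp_all
  have cc: "R' * ?Z * L' \<in> carrier_mat n n"
    using mult_carrier_mat[OF mult_carrier_mat[OF c(4) Zc(1)] c(2)] .
  note ZL = mult_carrier_mat[OF Zc(1) c(2)]
  have "R * (R' * ?Z * L') = R * R' * (?Z * L')"
    unfolding assoc_mult_mat[OF c(4) Zc(1) c(2)] by (rule assoc_mult_mat[OF c(3,4) ZL, symmetric])
  then have RX: "R * (R' * ?Z * L') = ?Z * L'"
    unfolding LR(6) left_mult_one_mat[OF ZL] .
  have "A * (R' * ?Z * L') = L * ?S * (R * (R' * ?Z * L'))"
    unfolding LR(7) by (rule assoc_mult_mat[OF mult_carrier_mat[OF c(1) Zc(2)] c(3) cc])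
  also have "\<dots> = L * (?S * (?Z * L'))"
    unfolding RX by (rule assoc_mult_mat[OF c(1) Zc(2) ZL])
  also have "?S * (?Z * L') = L'"
    unfolding assoc_mult_mat[OF Zc(2,1) c(2), symmetric] SZ using c(2) by simp
  finally have inv: "A * (R' * ?Z * L') = 1\<^sub>m n"
    unfolding LR(5) .
  \<comment> \<open>A right inverse of \<open>A\<close> coincides with the two-sided inverse
    \<open>Q\<close>.\<close>
  have "R' * ?Z * L' = Q * A * (R' * ?Z * L')"
    unfolding Q(3) left_mult_one_mat[OF cc] ..
  also have "\<dots> = Q * (A * (R' * ?Z * L'))"
    by (rule assoc_mult_mat[OF Q(1) A cc])
  also have "\<dots> = Q"
    unfolding inv using Q(1) by simp
  finally show "loc.oequiv l n n Q ?Z"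
    by (intro loc.oequivI[OF Zc(1) LR(4,2)]) simp
qed

text \<open>The identity is a left inverse of the stacked matrix, cut into the columns belonging to
  \<open>A\<close> and to \<open>C\<close>.\<close>

lemma local_bezout_left:
  fixes A C :: "'a::field poly mat"
  assumes A: "A \<in> carrier_mat n n" and C: "C \<in> carrier_mat p n"
    and rank: "n > 0 \<longrightarrow> vec_space.rank (n + p) (eval_mat A l @\<^sub>r eval_mat C l) = n"
  obtains X Y where "X \<in> loc.omat l n n" "Y \<in> loc.omat l n p"
    "X * map_mat to_fract A + Y * map_mat to_fract C = 1\<^sub>m n"
proof (cases "n = 0")
  \<comment> \<open>Minimality imposes no rank condition for \<open>n = 0\<close>; both sides are
    then empty matrices.\<close>
  case True
  then show ?thesis
    using A C by (intro that[of "0\<^sub>m n n" "0\<^sub>m n p"]) (auto intro!: eq_matI)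
next
  case False
  have "eval_mat (A @\<^sub>r C) l = eval_mat A l @\<^sub>r eval_mat C l"
    using A C by (intro eq_matI) (auto simp: eval_mat_def append_rows_def)
  then obtain X0 where X0: "X0 \<in> loc.omat l n (n + p)" "X0 * map_mat to_fract (A @\<^sub>r C) = 1\<^sub>m n"
    using local_left_inverse[OF carrier_append_rows[OF A C], of l] rank False by auto
  define X where "X = mat n n (\<lambda>(i, j). X0 $$ (i, j))"
  define Y where "Y = mat n p (\<lambda>(i, j). X0 $$ (i, n + j))"
  have XY: "X \<in> loc.omat l n n" "Y \<in> loc.omat l n p"
    using X0(1) by (auto simp: loc.omat_def X_def Y_def)
  note c = XY[THEN loc.omat_carrier] A C
  have 1: "X0 = four_block_mat X Y (0\<^sub>m 0 n) (0\<^sub>m 0 p)"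
    using loc.omat_carrier[OF X0(1)] by (intro eq_matI) (auto simp: X_def Y_def)
  have 2: "map_mat to_fract (A @\<^sub>r C) = four_block_mat (map_mat to_fract A) (0\<^sub>m n 0) (map_mat to_fract C) (0\<^sub>m p 0)"
    using A C by (intro eq_matI) (auto simp: append_rows_def)
  have "X0 * map_mat to_fract (A @\<^sub>r C) = X * map_mat to_fract A + Y * map_mat to_fract C"
    unfolding 1 2 using c
    by (subst mult_four_block_mat[of _ n n _ p _ 0 _ _ n _ 0])
      (auto intro!: four_block_mat_empty[of _ n n] add_carrier_mat mult_carrier_mat)
  then show ?thesis
    using that XY X0(2) by simp
qed

lemma local_bezout_right:
  fixes A B :: "'a::field poly mat"
  assumes A: "A \<in> carrier_mat n n" and B: "B \<in> carrier_mat n m"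
    and rank: "n > 0 \<longrightarrow> vec_space.rank n (append_cols (eval_mat A l) (eval_mat B l)) = n"
  obtains X Y where "X \<in> loc.omat l n n" "Y \<in> loc.omat l m n"
    "map_mat to_fract A * X + map_mat to_fract B * Y = 1\<^sub>m n"
proof (cases "n = 0")
  case True
  then show ?thesis
    using A B by (intro that[of "0\<^sub>m n n" "0\<^sub>m m n"]) (auto intro!: eq_matI)
next
  case False
  have AB: "append_cols A B \<in> carrier_mat n (n + m)"
    using A B four_block_carrier_mat[of A n n "0\<^sub>m 0 m" 0 m] by (simp add: append_cols_def)
  have "eval_mat (append_cols A B) l = append_cols (eval_mat A l) (eval_mat B l)"
    using A B by (intro eq_matI) (auto simp: eval_mat_def append_cols_def)
  then obtain X0 where X0: "X0 \<in> loc.omat l (n + m) n" "map_mat to_fract (append_cols A B) * X0 = 1\<^sub>m n"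
    using local_right_inverse[OF AB, of l] rank False by auto
  define X where "X = mat n n (\<lambda>(i, j). X0 $$ (i, j))"
  define Y where "Y = mat m n (\<lambda>(i, j). X0 $$ (n + i, j))"
  have XY: "X \<in> loc.omat l n n" "Y \<in> loc.omat l m n"
    using X0(1) by (auto simp: loc.omat_def X_def Y_def)
  note c = XY[THEN loc.omat_carrier] A B
  have 1: "X0 = four_block_mat X (0\<^sub>m n 0) Y (0\<^sub>m m 0)"
    using loc.omat_carrier[OF X0(1)] by (intro eq_matI) (auto simp: X_def Y_def)
  have 2: "map_mat to_fract (append_cols A B) = four_block_mat (map_mat to_fract A) (map_mat to_fract B) (0\<^sub>m 0 n) (0\<^sub>m 0 m)"
    using A B by (intro eq_matI) (auto simp: append_cols_def)
  have "map_mat to_fract (append_cols A B) * X0 = map_mat to_fract A * X + map_mat to_fract B * Y"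
    unfolding 1 2 using c
    by (subst mult_four_block_mat[of _ n n _ m _ 0 _ _ n _ 0])
      (auto intro!: four_block_mat_empty[of _ n n] add_carrier_mat mult_carrier_mat)
  then show ?thesis
    using that XY X0(2) by simp
qed

lemma image_mset_nth: "image_mset (\<lambda>i. f (xs ! i)) (mset_set {..<length xs}) = image_mset f (mset xs)"
proof -
  have "mset xs = mset (map (\<lambda>i. xs ! i) [0..<length xs])"
    by (simp only: map_nth)
  then have "mset xs = image_mset (\<lambda>i. xs ! i) (mset_set {..<length xs})"
    by (simp only: mset_map mset_upt lessThan_atLeast0)
  then show ?thesis by (simp add: multiset.map_comp comp_def)
qed

section \<open>Comparison of the orders of the system and of its transfer function\<close>

text \<open>Uniqueness is applied to two monomial forms of the block sum of $P$ and $A^{-1}$: the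
  block sum of their own forms, and the bordered form of the transfer function.\<close>

theorem invariant_orders_system:
  fixes A B C D :: "'a::field poly mat" and l :: 'a
  assumes sys: "is_polynomial_system n p m A B C D" and min: "minimal_at A B C l"
  defines "orders \<equiv> \<lambda>M. mset (invariant_orders M l)"
  shows "orders (map_mat to_fract (system_matrix A B C D)) + image_mset uminus (orders (map_mat to_fract A))
    = orders (transfer_function A B C D) + replicate_mset (2 * n) 0"
proof -
  have c: "A \<in> carrier_mat n n" "B \<in> carrier_mat n m" "C \<in> carrier_mat p n" "D \<in> carrier_mat p m"
    using sys by (auto simp: is_polynomial_system_def)
  define A' B' C' D' where defs: "A' = map_mat to_fract A" "B' = map_mat to_fract B"
    "C' = map_mat to_fract C" "D' = map_mat to_fract D"
  have om: "A' \<in> loc.omat l n n" "B' \<in> loc.omat l n m" "C' \<in> loc.omat l p n" "D' \<in> loc.omat l p m"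
    using c by (auto simp: defs)
  note cm = om[THEN loc.omat_carrier]
  \<comment> \<open>The system definition demands this for \<open>n > 0\<close>; the empty
    determinant is 1.\<close>
  have "det A \<noteq> 0"
  proof (cases "n = 0")
    case True
    then have "A = 1\<^sub>m 0" using c(1) by (intro eq_matI) auto
    then show ?thesis by simp
  qed (use sys in \<open>auto simp: is_polynomial_system_def\<close>)
  then have det: "det A' \<noteq> 0" by (simp add: defs)
  define Q where "Q = the (mat_inverse A')"
  \<comment> \<open>The nonzero determinant shows that the \<open>the\<close> in the transfer
    function is applied to a proper value.\<close>
  obtain Q0 where "mat_inverse A' = Some Q0"
    using mat_inverse(1)[OF cm(1), of "()"] det_non_zero_imp_unit[OF cm(1) det, of "()"] by (cases "mat_inverse A'") auto
  then have Q: "Q \<in> carrier_mat n n" "A' * Q = 1\<^sub>m n" "Q * A' = 1\<^sub>m n"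
    using mat_inverse(2)[OF cm(1)] by (auto simp: Q_def)
  have G: "transfer_function A B C D = D' + C' * Q * B'"
    by (simp add: transfer_function_def defs Q_def)
  have Gc: "D' + C' * Q * B' \<in> carrier_mat p m"
    by (rule add_carrier_mat[OF mult_carrier_mat[OF mult_carrier_mat[OF cm(3) Q(1)] cm(2)]])
  have P: "map_mat to_fract (system_matrix A B C D) = four_block_mat A' B' (- C') D'"
    using c by (intro eq_matI) (auto simp: system_matrix_def defs)
  have Pc: "four_block_mat A' B' (- C') D' \<in> carrier_mat (n + p) (n + m)"
    using cm by simp
  obtain X Y where XY: "X \<in> loc.omat l n n" "Y \<in> loc.omat l m n" "A' * X + B' * Y = 1\<^sub>m n"
    using local_bezout_right[OF c(1,2), of l] min c unfolding defs minimal_at_def Let_def by auto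
  obtain X' Y' where XY': "X' \<in> loc.omat l n n" "Y' \<in> loc.omat l n p" "X' * A' + Y' * C' = 1\<^sub>m n"
    using local_bezout_left[OF c(1,3), of l] min c unfolding defs minimal_at_def Let_def by auto
  define as where "as = invariant_orders A' l"
  define ps where "ps = invariant_orders (four_block_mat A' B' (- C') D') l"
  define gs where "gs = invariant_orders (D' + C' * Q * B') l"
  let ?T = "uniformizer l"
  have Dp: "monomial_data (n + p) (n + m) {..<length ps} id (\<lambda>i. ?T powi (ps ! i))"
    unfolding ps_def by (intro monomial_data_smith oequiv_smith(2,3)[OF Pc])
  have Dg: "monomial_data p m {..<length gs} id (\<lambda>i. ?T powi (gs ! i))"
    unfolding gs_def by (intro monomial_data_smith oequiv_smith(2,3)[OF Gc])
  have Da: "monomial_data n n {..<n} id (\<lambda>i. ?T powi (- (as ! i)))"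
    by (auto simp: monomial_data_def)
  note len_as = oequiv_inverse_smith(1)[OF cm(1) det Q, of l, folded as_def]
  note diag = monomial_mat_diag_block[OF Dp Da]
  note border = monomial_mat_border[OF Dg, of n]
  define K where "K = {..<length ps} \<union> (+) (n + p) ` {..<n}"
  define v where "v i = (if i < n + p then ps ! i else - (as ! (i - (n + p))))" for i
  define K' where "K' = {..<n} \<union> (+) n ` {..<length gs} \<union> {n + p..<n + p + n}"
  define v' where "v' i = (if n \<le> i \<and> i < n + p then gs ! (i - n) else 0)" for i
  have v: "(\<lambda>i. if i < n + p then ?T powi (ps ! i) else ?T powi (- (as ! (i - (n + p))))) = (\<lambda>i. ?T powi v i)"
    by (auto simp: v_def fun_eq_iff)
  have v': "(\<lambda>i. if n \<le> i \<and> i < n + p then ?T powi (gs ! (i - n)) else 1) = (\<lambda>i. ?T powi v' i)"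
    by (auto simp: v'_def fun_eq_iff)
  have "loc.oequiv l (n + p) (n + m) (four_block_mat A' B' (- C') D') (monomial_mat (n + p) (n + m) {..<length ps} id (\<lambda>i. ?T powi (ps ! i)))"
    using oequiv_smith(1)[OF Pc, of l] by (simp only: local_smith_mat_eq_monomial_mat ps_def)
  from loc.oequiv_diag_block[OF this oequiv_inverse_smith(2)[OF cm(1) det Q, of l, folded as_def]]
  have eq1: "loc.oequiv l (n + p + n) (n + m + n)
    (four_block_mat (four_block_mat A' B' (- C') D') (0\<^sub>m (n + p) n) (0\<^sub>m n (n + m)) Q)
    (monomial_mat (n + p + n) (n + m + n) K (\<lambda>i. if i < n + p then id i else n + m + id (i - (n + p))) (\<lambda>i. ?T powi v i))"
    unfolding diag(2) v K_def .
  have "loc.oequiv l p m (D' + C' * Q * B') (monomial_mat p m {..<length gs} id (\<lambda>i. ?T powi (gs ! i)))"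
    using oequiv_smith(1)[OF Gc, of l] by (simp only: local_smith_mat_eq_monomial_mat gs_def)
  from loc.oequiv_system_transfer[OF om Q XY XY' this]
  have eq2: "loc.oequiv l (n + p + n) (n + m + n)
    (four_block_mat (four_block_mat A' B' (- C') D') (0\<^sub>m (n + p) n) (0\<^sub>m n (n + m)) Q)
    (monomial_mat (n + p + n) (n + m + n) K' (\<lambda>i. if i < n then n + m + i else if i < n + p then n + id (i - n) else i - (n + p))
      (\<lambda>i. ?T powi v' i))"
    unfolding border(2) v' K'_def .
  have eq: "image_mset v (mset_set K) = image_mset v' (mset_set K')"
    by (rule image_mset_orders_unique[OF loc.oequiv_trans[OF loc.oequiv_sym[OF eq1] eq2]
          diag(1)[unfolded v, folded K_def] border(1)[unfolded v', folded K'_def]])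
  have len: "length ps \<le> n + p" "length gs \<le> p"
    using oequiv_smith(2)[OF Pc, of l] oequiv_smith(2)[OF Gc, of l] by (simp_all add: ps_def gs_def)
  \<comment> \<open>The pivot rows of the two blocks are disjoint, so the multiset of exponents
    splits.\<close>
  have "{..<length ps} \<inter> (+) (n + p) ` {..<n} = {}"
    using len by auto
  then have "image_mset v (mset_set K)
      = image_mset v (mset_set {..<length ps}) + image_mset v (mset_set ((+) (n + p) ` {..<n}))"
    by (simp add: K_def mset_set_Union)
  also have "image_mset v (mset_set {..<length ps}) = image_mset (\<lambda>i. ps ! i) (mset_set {..<length ps})"
    using len by (intro image_mset_cong) (auto simp: v_def)
  also have "\<dots> = mset ps"
    using image_mset_nth[of "\<lambda>x. x" ps] by simp
  also have "image_mset v (mset_set ((+) (n + p) ` {..<n})) = image_mset uminus (mset as)"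
    unfolding image_mset_shifted using image_mset_nth[of uminus as] len_as by (simp add: v_def)
  finally have 1: "image_mset v (mset_set K) = mset ps + image_mset uminus (mset as)" .
  have disj: "{..<n} \<inter> (+) n ` {..<length gs} = {}" "({..<n} \<union> (+) n ` {..<length gs}) \<inter> {n + p..<n + p + n} = {}"
    using len by auto
  have "image_mset v' (mset_set K') = image_mset v' (mset_set {..<n})
      + image_mset v' (mset_set ((+) n ` {..<length gs})) + image_mset v' (mset_set {n + p..<n + p + n})"
    using disj by (simp add: K'_def mset_set_Union)
  also have "image_mset v' (mset_set {..<n}) = image_mset (\<lambda>_. 0) (mset_set {..<n})"
    by (intro image_mset_cong) (auto simp: v'_def)
  also have "\<dots> = replicate_mset n 0"
    by (simp add: image_mset_const_eq)
  also have "image_mset v' (mset_set ((+) n ` {..<length gs})) = image_mset (\<lambda>i. gs ! i) (mset_set {..<length gs})"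
    unfolding image_mset_shifted using len by (intro image_mset_cong) (auto simp: v'_def)
  also have "\<dots> = mset gs"
    using image_mset_nth[of "\<lambda>x. x" gs] by simp
  also have "image_mset v' (mset_set {n + p..<n + p + n}) = image_mset (\<lambda>_. 0) (mset_set {n + p..<n + p + n})"
    by (intro image_mset_cong) (auto simp: v'_def)
  also have "\<dots> = replicate_mset n 0"
    by (simp add: image_mset_const_eq)
  also have "replicate_mset n 0 + mset gs + replicate_mset n 0 = mset gs + replicate_mset (2 * n) 0"
    by (rule multiset_eqI) simp
  finally have 2: "image_mset v' (mset_set K') = mset gs + replicate_mset (2 * n) 0" .
  show ?thesis
    using eq 1 2 unfolding orders_def P G by (simp add: as_def ps_def gs_def defs(1))
qed

lemma elementary_divisors_at_system:
  fixes A B C D :: "'a::field poly mat" and l :: 'a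
  assumes sys: "is_polynomial_system n p m A B C D" and min: "minimal_at A B C l"
  shows "elementary_divisors_at A l = pole_elementary_divisors_at (transfer_function A B C D) l"
    and "elementary_divisors_at (system_matrix A B C D) l = zero_elementary_divisors_at (transfer_function A B C D) l"
proof -
  define as where "as = mset (invariant_orders (map_mat to_fract A) l)"
  define ps where "ps = mset (invariant_orders (map_mat to_fract (system_matrix A B C D)) l)"
  define gs where "gs = mset (invariant_orders (transfer_function A B C D) l)"
  have c: "A \<in> carrier_mat n n" "system_matrix A B C D \<in> carrier_mat (n + p) (n + m)"
    using sys by (auto simp: is_polynomial_system_def system_matrix_def)
  have as0: "\<nu> \<ge> 0" if "\<nu> \<in># as" for \<nu>
    using invariant_orders_nonneg[OF map_to_fract_omat[OF c(1)]] that by (auto simp: as_def)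
  have ps0: "\<nu> \<ge> 0" if "\<nu> \<in># ps" for \<nu>
    using invariant_orders_nonneg[OF map_to_fract_omat[OF c(2)]] that by (auto simp: ps_def)
  have eq: "ps + image_mset uminus as = gs + replicate_mset (2 * n) 0"
    using invariant_orders_system[OF assms] by (simp add: as_def ps_def gs_def)
  have zero: "filter_mset (\<lambda>\<nu>. \<nu> < 0) (replicate_mset k (0::int)) = {#}" "filter_mset (\<lambda>\<nu>. \<nu> > 0) (replicate_mset k (0::int)) = {#}" for k
    by (induction k) auto
  have "filter_mset (\<lambda>\<nu>. \<nu> < 0) ps = {#}"
    using ps0 by (simp add: not_less)
  \<comment> \<open>A negated order of \<open>A\<close> is never positive, and it is negative
    exactly if the order is nonzero. No order of \<open>P\<close> is negative, so nothing
    cancels.\<close>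
  moreover have "filter_mset (\<lambda>\<nu>. \<nu> < 0) (image_mset uminus as) = image_mset uminus (filter_mset (\<lambda>\<nu>. \<nu> \<noteq> 0) as)"
    unfolding filter_mset_image_mset using as0 by (intro arg_cong[of _ _ "image_mset uminus"] filter_mset_cong) force+
  ultimately have neg: "filter_mset (\<lambda>\<nu>. \<nu> < 0) gs = image_mset uminus (filter_mset (\<lambda>\<nu>. \<nu> \<noteq> 0) as)"
    using arg_cong[OF eq, of "filter_mset (\<lambda>\<nu>. \<nu> < 0)"] by (simp add: zero del: filter_mset_eq_mempty_iff)
  have "filter_mset (\<lambda>\<nu>. \<nu> > 0) (image_mset uminus as) = {#}"
    using as0 by (force)
  moreover have "filter_mset (\<lambda>\<nu>. \<nu> > 0) ps = filter_mset (\<lambda>\<nu>. \<nu> \<noteq> 0) ps"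
    using ps0 by (intro filter_mset_cong) force+
  ultimately have pos: "filter_mset (\<lambda>\<nu>. \<nu> > 0) gs = filter_mset (\<lambda>\<nu>. \<nu> \<noteq> 0) ps"
    using arg_cong[OF eq, of "filter_mset (\<lambda>\<nu>. \<nu> > 0)"] by (simp add: zero del: filter_mset_eq_mempty_iff)
  show "elementary_divisors_at A l = pole_elementary_divisors_at (transfer_function A B C D) l"
    unfolding elementary_divisors_at_def pole_elementary_divisors_at_def as_def[symmetric] gs_def[symmetric] neg
    by (simp add: multiset.map_comp comp_def)
  show "elementary_divisors_at (system_matrix A B C D) l = zero_elementary_divisors_at (transfer_function A B C D) l"
    unfolding elementary_divisors_at_def zero_elementary_divisors_at_def ps_def[symmetric] gs_def[symmetric] pos ..
qed

theorem theorem3p7: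
  fixes \<Sigma> :: "'a::alg_closed_field set"
    and G :: "'a poly fract mat"
    and A B C D P :: "'a poly mat"
    and n p m :: nat
  assumes "\<Sigma> \<noteq> {}"
    and "G \<in> carrier_mat p m"
    and "is_polynomial_system n p m A B C D"
    and "P = system_matrix A B C D"
    and "minimal_in A B C \<Sigma>"
    and "transfer_function A B C D = G"
  shows "elementary_divisors_in \<Sigma> A = pole_elementary_divisors_in \<Sigma> G \<and>
         elementary_divisors_in \<Sigma> P = zero_elementary_divisors_in \<Sigma> G"
proof -
  \<comment> \<open>Equality at each point of the set suffices, since the sum only involves those
    points.\<close>
  have cong: "collected_in \<Sigma> E = collected_in \<Sigma> F" if "\<And>l. l \<in> \<Sigma> \<Longrightarrow> E l = F l" for E F :: "'a \<Rightarrow> 'a poly multiset"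
    using that by (auto simp: collected_in_def fun_eq_iff intro!: sum.cong)
  have "elementary_divisors_at A l = pole_elementary_divisors_at G l"
    "elementary_divisors_at P l = zero_elementary_divisors_at G l" if "l \<in> \<Sigma>" for l
    using elementary_divisors_at_system[OF assms(3), of l] assms(4-6) that by (auto simp: minimal_in_def)
  then show ?thesis
    unfolding elementary_divisors_in_def pole_elementary_divisors_in_def zero_elementary_divisors_in_def
    by (intro conjI cong)
qed

end
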